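(* Let $X$ be a metric space and let $T\subseteq X$ be a non-meagre set with the Baire property. Let $G$ be a group equipped with a right-invariant metric under which $G$ is a Baire space, and let $\varphi:G\times X\to X$ be a separately continuous, transitive Nikodym action of $G$ on $X$ (write $gx=g(x)=\varphi(g,x)$). Then for every convergent sequence $x_n\to x$ in $X$ and every non-meagre set $A\subseteq G$ with the Baire property such that $e_G\in A^{q}$ and $A^{q}x\cap T^{q}\neq\emptyset$, there exist $\alpha\in A$ and an integer $N$ such that $\alpha x\in T$ and \[\{\alpha(x_n):n>N\}\subseteq T.\] Moreover, the same conclusion holds if, in place of the Nikodym property of the action, one assumes that $G$ is analytic and all point-evaluation maps $\varphi_x:g\mapsto\varphi(g,x)$ are base-$\sigma$-discrete.
   Context: All spaces are metrizable (not necessarily separable). A group action $\varphi:G\times X\to X$ satisfies $\varphi(e_G,x)=x$ and $\varphi(gh,x)=\varphi(g,\varphi(h,x))$. It is separately continuous if $x\mapsto\varphi(g,x)$ is continuous for each $g$ and $\varphi_x:g\mapsto\varphi(g,x)$ is continuous for each $x$; transitive if for all $x,y\in X$ there is $g$ with $g(x)=y$. For $U\subseteq G$, $Ux=\{u(x):u\in U\}$. The action is a Nikodym action if for every non-empty open neighbourhood $U$ of $e_G$ and every $x\in X$, the set $Ux$ contains a non-meagre set with the Baire property. A set is "Baire" if it has the Baire property. The quasi-interior $A^{q}$ of a set $A$ is the largest open set $U$ with $U\setminus A$ meagre. A metrizable space is (absolutely) analytic if it embeds in its own metric completion as a Souslin-$\mathcal F$ set, i.e. a set of the form $\bigcup_{i\in\mathbb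 N^{\mathbb N}}\bigcap_{n}H(i|n)$ with each $H(i|n)$ closed, where $i|n=(i_1,\dots,i_n)$. A family of sets is discrete if every point has a neighbourhood meeting at most one member; $\sigma$-discrete if it is a countable union of discrete families; a family $\mathcal B$ is a base for a family $\mathcal A$ if each member of $\mathcal A$ is a union of members of $\mathcal B$. A map $f:X\to Y$ is base-$\sigma$-discrete if for every discrete family $\mathcal E$ in $X$, the family $\{f(E):E\in\mathcal E\}$ has a $\sigma$-discrete base in $Y$. *)

theory Defs
  imports "HOL-Analysis.Analysis" "HOL-Algebra.Group"
begin

definition nowhere_dense :: "'a::topological_space set \<Rightarrow> bool" where
  "nowhere_dense S \<longleftrightarrow> interior (closure S) = {}"

definition meagre :: "'a::topological_space set \<Rightarrow> bool" where
  "meagre S \<longleftrightarrow> (\<exists>F. countable F \<and> (\<forall>N\<in>F. nowhere_dense N) \<and> S \<subseteq> \<Union>F)"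

definition baire_prop :: "'a::topological_space set \<Rightarrow> bool" where
  "baire_prop S \<longleftrightarrow> (\<exists>U. open U \<and> meagre ((S - U) \<union> (U - S)))"

definition baire_space :: "'a::topological_space itself \<Rightarrow> bool" where
  "baire_space _ \<longleftrightarrow> (\<forall>U::'a set. open U \<and> U \<noteq> {} \<longrightarrow> \<not> meagre U)"

definition qint :: "'a::topological_space set \<Rightarrow> 'a set" where
  "qint A = \<Union>{U. open U \<and> meagre (U - A)}"

definition group_action :: "('g \<Rightarrow> 'g \<Rightarrow> 'g) \<Rightarrow> 'g \<Rightarrow> ('g \<Rightarrow> 'x \<Rightarrow> 'x) \<Rightarrow> bool" where
  "group_action m e \<phi> \<longleftrightarrow> (\<forall>x. \<phi> e x = x) \<and> (\<forall>g h x. \<phi> (m g h) x = \<phi> g (\<phi> h x))"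

definition sep_continuous_action :: "('g::topological_space \<Rightarrow> 'x::topological_space \<Rightarrow> 'x) \<Rightarrow> bool" where
  "sep_continuous_action \<phi> \<longleftrightarrow> (\<forall>g. continuous_on UNIV (\<phi> g)) \<and> (\<forall>x. continuous_on UNIV (\<lambda>g. \<phi> g x))"

definition transitive_action :: "('g \<Rightarrow> 'x \<Rightarrow> 'x) \<Rightarrow> bool" where
  "transitive_action \<phi> \<longleftrightarrow> (\<forall>x y. \<exists>g. \<phi> g x = y)"

definition nikodym_action :: "'g::topological_space \<Rightarrow> ('g \<Rightarrow> 'x::topological_space \<Rightarrow> 'x) \<Rightarrow> bool" where
  "nikodym_action e \<phi> \<longleftrightarrow> (\<forall>U x. open U \<and> e \<in> U \<longrightarrow>
      (\<exists>B. B \<subseteq> (\<lambda>u. \<phi> u x) ` U \<and> \<not> meagre B \<and> baire_prop B))"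

definition souslin_F :: "'a::topological_space set \<Rightarrow> bool" where
  "souslin_F S \<longleftrightarrow> (\<exists>H :: nat list \<Rightarrow> 'a set. (\<forall>s. closed (H s)) \<and>
      S = (\<Union>i::nat \<Rightarrow> nat. \<Inter>n. H (map i [0..<Suc n])))"

text \<open>'c is a metric completion of 'a via the isometric dense embedding j, in which
  the image of 'a is Souslin-F.\<close>
definition analytic_via :: "('a::metric_space \<Rightarrow> 'c::complete_space) \<Rightarrow> bool" where
  "analytic_via j \<longleftrightarrow> (\<forall>a b. dist (j a) (j b) = dist a b) \<and> closure (range j) = UNIV
      \<and> souslin_F (range j)"

definition discrete_family :: "'a::topological_space set set \<Rightarrow> bool" where
  "discrete_family F \<longleftrightarrow> (\<forall>x. \<exists>U. open U \<and> x \<in> U \<and>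
      (\<forall>A\<in>F. \<forall>B\<in>F. A \<inter> U \<noteq> {} \<and> B \<inter> U \<noteq> {} \<longrightarrow> A = B))"

definition sigma_discrete :: "'a::topological_space set set \<Rightarrow> bool" where
  "sigma_discrete F \<longleftrightarrow> (\<exists>Fs :: nat \<Rightarrow> 'a set set. F = (\<Union>n. Fs n) \<and> (\<forall>n. discrete_family (Fs n)))"

definition base_for :: "'a set set \<Rightarrow> 'a set set \<Rightarrow> bool" where
  "base_for B A \<longleftrightarrow> (\<forall>S\<in>A. \<exists>B'\<subseteq>B. S = \<Union>B')"

definition base_sigma_discrete :: "('a::topological_space \<Rightarrow> 'b::topological_space) \<Rightarrow> bool" where
  "base_sigma_discrete f \<longleftrightarrow> (\<forall>E. discrete_family E \<longrightarrow>
      (\<exists>B. sigma_discrete B \<and> base_for B ((\<lambda>S. f ` S) ` E)))"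

end

theory Submission
  imports Defs
begin

text \<open>Everything reduces to showing that \<open>Ux\<close> is non-meagre for every neighbourhood \<open>U\<close> of the unit
  and every \<open>x\<close>: evaluation maps then pull meagre sets back to meagre sets, the set of
  those \<open>g\<close> in \<open>A\<^sup>q\<close> with \<open>gx \<in> T\<^sup>q\<close> is the union over \<open>N\<close> of the sets where moreover
  \<open>gx\<^sub>n \<in> T\<^sup>q\<close> for all \<open>n > N\<close>, and countably many meagre sets of bad \<open>g\<close> may be removed. For a
  Nikodym action there is nothing more to show.

  In the other case, call a point fat if none of its small orbits \<open>B\<^sub>r p\<close> is \<open>\<sigma>\<close>-discrete. Base-\<open>\<sigma>\<close>-discreteness
  makes the set of non-fat points \<open>\<sigma>\<close>-discrete, and a Cantor scheme, the only place
  where analyticity enters, puts a Cantor set into each small orbit of a fat point; hence stabilizers of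
  fat points are separable. If no stabilizer is open, this separability shows that every
  conjugate \<open>v\<^sup>-\<^sup>1 B\<^sub>r v\<close> is non-meagre, hence dense in some ball. So if \<open>B\<^sub>r w\<close> were nowhere dense for some \<open>w = vz\<close>,
  then so would be a small orbit of \<open>z\<close>, although \<open>z\<close> can be chosen with all \<open>B\<^sub>r z\<close> non-meagre.
  Open stabilizers have to be excluded separately: left translations of the group need not be
  continuous, so a conjugate of an open stabilizer need not be open.\<close>

section \<open>Meagre and \<open>\<sigma>\<close>-discrete sets\<close>

text \<open>A sigma-ideal that is also closed under discrete unions. Meagre sets and sigma-discrete
  sets are both of this kind, so localization is carried out once for a variable ideal
  \<open>I\<close>.\<close>

definition discr_ideal :: "('a::topological_space set \<Rightarrow> bool) \<Rightarrow> bool" where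
  "discr_ideal I \<longleftrightarrow> (\<forall>A B. I A \<longrightarrow> B \<subseteq> A \<longrightarrow> I B)
     \<and> (\<forall>F. countable F \<longrightarrow> (\<forall>A\<in>F. I A) \<longrightarrow> I (\<Union>F))
     \<and> (\<forall>F. discrete_family F \<longrightarrow> (\<forall>A\<in>F. I A) \<longrightarrow> I (\<Union>F))"

text \<open>Discreteness is that of the family of singletons in the whole space: every point of the
  space, not only of \<open>D n\<close>, has a neighbourhood with at most one point of
  \<open>D n\<close>. In a T1 space such a set is closed.\<close>

definition sigma_discrete_set :: "'a::topological_space set \<Rightarrow> bool" where
  "sigma_discrete_set N \<longleftrightarrow>
     (\<exists>D::nat \<Rightarrow> 'a set. N = (\<Union>n. D n) \<and> (\<forall>n. discrete_family ((\<lambda>x. {x}) ` D n)))"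

lemma discr_idealD:
  assumes "discr_ideal I"
  shows "I A \<Longrightarrow> B \<subseteq> A \<Longrightarrow> I B"
    and "countable F \<Longrightarrow> (\<And>A. A \<in> F \<Longrightarrow> I A) \<Longrightarrow> I (\<Union>F)"
    and "discrete_family F \<Longrightarrow> (\<And>A. A \<in> F \<Longrightarrow> I A) \<Longrightarrow> I (\<Union>F)"
  using assms unfolding discr_ideal_def by blast+

lemma discr_ideal_UN:
  assumes "discr_ideal I" "\<And>n::nat. I (A n)"
  shows "I (\<Union>n. A n)"
  using discr_idealD(2)[OF assms(1), of "range A"] assms(2) by auto

section \<open>Discrete families of sets\<close>

lemma discrete_family_subset: "discrete_family F \<Longrightarrow> F' \<subseteq> F \<Longrightarrow> discrete_family F'"
  unfolding discrete_family_def by (meson subsetD)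

lemma discrete_family_nhd:
  assumes "discrete_family F"
  obtains U where "open U" "x \<in> U"
    "\<And>A B. A \<in> F \<Longrightarrow> B \<in> F \<Longrightarrow> A \<inter> U \<noteq> {} \<Longrightarrow> B \<inter> U \<noteq> {} \<Longrightarrow> A = B"
  using assms unfolding discrete_family_def by metis

lemma discrete_family_imageI:
  assumes "\<And>x. \<exists>U. open U \<and> x \<in> U \<and>
    (\<forall>a\<in>S. \<forall>b\<in>S. h a \<inter> U \<noteq> {} \<longrightarrow> h b \<inter> U \<noteq> {} \<longrightarrow> h a = h b)"
  shows "discrete_family (h ` S)"
  unfolding discrete_family_def
proof
  fix x
  obtain U where U: "open U" "x \<in> U"
    "\<And>a b. a \<in> S \<Longrightarrow> b \<in> S \<Longrightarrow> h a \<inter> U \<noteq> {} \<Longrightarrow> h b \<inter> U \<noteq> {} \<Longrightarrow> h a = h b"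
    using assms[of x] by metis
  have "\<forall>A\<in>h ` S. \<forall>B\<in>h ` S. A \<inter> U \<noteq> {} \<and> B \<inter> U \<noteq> {} \<longrightarrow> A = B"
    using U(3) by (metis imageE)
  then show "\<exists>U. open U \<and> x \<in> U \<and> (\<forall>A\<in>h ` S. \<forall>B\<in>h ` S. A \<inter> U \<noteq> {} \<and> B \<inter> U \<noteq> {} \<longrightarrow> A = B)"
    using U(1,2) by (intro exI[of _ U]) simp
qed

lemma discrete_family_shrink:
  assumes "discrete_family F" "\<And>A. A \<in> F \<Longrightarrow> h A \<subseteq> A"
  shows "discrete_family (h ` F)"
proof (rule discrete_family_imageI)
  fix x
  obtain U where U: "open U" "x \<in> U"
    "\<And>A B. A \<in> F \<Longrightarrow> B \<in> F \<Longrightarrow> A \<inter> U \<noteq> {} \<Longrightarrow> B \<inter> U \<noteq> {} \<Longrightarrow> A = B"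
    using discrete_family_nhd[OF assms(1)] by metis
  have *: "A \<inter> U \<noteq> {}" if "h A \<inter> U \<noteq> {}" "A \<in> F" for A
    using that assms(2) by blast
  show "\<exists>U. open U \<and> x \<in> U \<and>
    (\<forall>a\<in>F. \<forall>b\<in>F. h a \<inter> U \<noteq> {} \<longrightarrow> h b \<inter> U \<noteq> {} \<longrightarrow> h a = h b)"
    by (metis U *)
qed

lemma discrete_family_vimage:
  assumes "discrete_family F" "continuous_on UNIV f"
  shows "discrete_family ((\<lambda>B. f -` B) ` F)"
proof (rule discrete_family_imageI)
  fix x
  obtain U where U: "open U" "f x \<in> U"
    "\<And>A B. A \<in> F \<Longrightarrow> B \<in> F \<Longrightarrow> A \<inter> U \<noteq> {} \<Longrightarrow> B \<inter> U \<noteq> {} \<Longrightarrow> A = B"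
    using discrete_family_nhd[OF assms(1)] by metis
  have op: "open (f -` U)"
    using U(1) assms(2) by (simp add: continuous_on_open_vimage)
  have *: "A = B" if "A \<in> F" "B \<in> F" "f -` A \<inter> f -` U \<noteq> {}" "f -` B \<inter> f -` U \<noteq> {}" for A B
    by (rule U(3)) (use that in blast)+
  have "\<forall>A\<in>F. \<forall>B\<in>F. f -` A \<inter> f -` U \<noteq> {} \<longrightarrow> f -` B \<inter> f -` U \<noteq> {} \<longrightarrow> f -` A = f -` B"
    by (intro ballI impI arg_cong[of _ _ "vimage f"] *)
  then show "\<exists>U. open U \<and> x \<in> U \<and>
      (\<forall>A\<in>F. \<forall>B\<in>F. f -` A \<inter> U \<noteq> {} \<longrightarrow> f -` B \<inter> U \<noteq> {} \<longrightarrow> f -` A = f -` B)"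
    using U(2) op by (intro exI[of _ "f -` U"]) simp
qed

section \<open>Nowhere dense, meagre and discrete sets as ideals\<close>

lemma nowhere_dense_subset: "nowhere_dense A \<Longrightarrow> B \<subseteq> A \<Longrightarrow> nowhere_dense B"
  unfolding nowhere_dense_def by (metis closure_mono interior_mono subset_empty)

lemma nowhere_dense_closure: "nowhere_dense A \<Longrightarrow> nowhere_dense (closure A)"
  unfolding nowhere_dense_def by simp

lemma nowhere_dense_imp_meagre: "nowhere_dense A \<Longrightarrow> meagre A"
  unfolding meagre_def by (intro exI[of _ "{A}"]) auto

lemma meagre_subset: "meagre A \<Longrightarrow> B \<subseteq> A \<Longrightarrow> meagre B"
  unfolding meagre_def by (meson subset_trans)

lemma meagre_seqE:
  assumes "meagre A"
  obtains N :: "nat \<Rightarrow> 'a::topological_space set"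
  where "\<And>n. nowhere_dense (N n)" "A \<subseteq> (\<Union>n. N n)"
proof -
  obtain F where F: "countable F" "\<forall>N\<in>F. nowhere_dense N" "A \<subseteq> \<Union>F"
    using assms unfolding meagre_def by blast
  have "countable (insert {} F)" using F(1) by simp
  then obtain N :: "nat \<Rightarrow> 'a set" where "range N = insert {} F"
    by (metis insert_not_empty uncountable_def)
  then have N: "N n \<in> insert {} F" for n by blast
  have "nowhere_dense (N n)" for n
    using N[of n] F(2) by (auto simp: nowhere_dense_def)
  moreover have "A \<subseteq> (\<Union>n. N n)"
    using F(3) \<open>range N = insert {} F\<close> by simp
  ultimately show thesis using that by blast
qed

lemma meagre_Union:
  assumes "countable F" "\<And>A. A \<in> F \<Longrightarrow> meagre A"
  shows "meagre (\<Union>F)"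
proof -
  from assms(2) obtain G where G: "\<And>A. A \<in> F \<Longrightarrow> countable (G A) \<and> (\<forall>N\<in>G A. nowhere_dense N) \<and> A \<subseteq> \<Union>(G A)"
    unfolding meagre_def by metis
  have "countable (\<Union>A\<in>F. G A)" using G assms(1) by (intro countable_UN) auto
  moreover have "\<forall>N\<in>(\<Union>A\<in>F. G A). nowhere_dense N" using G by blast
  moreover have "\<Union>F \<subseteq> \<Union>(\<Union>A\<in>F. G A)"
  proof
    fix x assume "x \<in> \<Union>F"
    then obtain A where "A \<in> F" "x \<in> A" by blast
    moreover obtain N where "N \<in> G A" "x \<in> N" using G[OF \<open>A \<in> F\<close>] \<open>x \<in> A\<close> by blast
    ultimately show "x \<in> \<Union>(\<Union>A\<in>F. G A)" by blast
  qed
  ultimately show ?thesis unfolding meagre_def by metis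
qed

text \<open>Near any point the union agrees with a single member, so an open set inside its closure
  would lie, locally, in the closure of that one nowhere dense member.\<close>

lemma nowhere_dense_discrete_Union:
  assumes "discrete_family F" "\<And>A. A \<in> F \<Longrightarrow> nowhere_dense A"
  shows "nowhere_dense (\<Union>F)"
  unfolding nowhere_dense_def
proof (rule ccontr)
  assume "interior (closure (\<Union>F)) \<noteq> {}"
  then obtain x where x: "x \<in> interior (closure (\<Union>F))" by blast
  obtain U where U: "open U" "x \<in> U"
    "\<And>A B. A \<in> F \<Longrightarrow> B \<in> F \<Longrightarrow> A \<inter> U \<noteq> {} \<Longrightarrow> B \<inter> U \<noteq> {} \<Longrightarrow> A = B"
    using assms(1) unfolding discrete_family_def by metis
  let ?V = "U \<inter> interior (closure (\<Union>F))"
  have V: "open ?V" "x \<in> ?V" using U x by auto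
  then have "?V \<inter> closure (\<Union>F) \<noteq> {}"
    using interior_subset[of "closure (\<Union>F)"] by blast
  then have "?V \<inter> \<Union>F \<noteq> {}"
    using open_Int_closure_eq_empty[OF V(1)] by blast
  then obtain A where A: "A \<in> F" "A \<inter> U \<noteq> {}" by blast
  have "\<Union>F \<inter> U \<subseteq> A" using U(3) A by blast
  moreover have "?V \<subseteq> closure (\<Union>F \<inter> U)"
    using U(1) interior_subset[of "closure (\<Union>F)"] open_Int_closure_subset[OF U(1), of "\<Union>F"]
    by (auto simp: Int_commute)
  ultimately have "?V \<subseteq> closure A" using closure_mono by blast
  then have "?V \<subseteq> interior (closure A)" using V(1) by (simp add: interior_maximal)
  with V(2) assms(2)[OF A(1)] show False unfolding nowhere_dense_def by blast
qed

text \<open>For discrete unions each member is covered by a sequence of nowhere dense sets. The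
  \<open>n\<close>-th pieces, intersected with their members, again form a discrete family with
  nowhere dense union.\<close>

lemma discr_ideal_meagre: "discr_ideal meagre"
  unfolding discr_ideal_def
proof (intro conjI allI impI)
  fix F :: "'a set set"
  assume F: "discrete_family F" "\<forall>A\<in>F. meagre A"
  have "\<exists>N::nat \<Rightarrow> 'a set. (\<forall>n. nowhere_dense (N n)) \<and> A \<subseteq> (\<Union>n. N n)" if "A \<in> F" for A
    using F(2) that meagre_seqE by metis
  then obtain N :: "'a set \<Rightarrow> nat \<Rightarrow> 'a set"
    where N: "\<And>A n. A \<in> F \<Longrightarrow> nowhere_dense (N A n)" "\<And>A. A \<in> F \<Longrightarrow> A \<subseteq> (\<Union>n. N A n)"
    by metis
  have "nowhere_dense (\<Union>((\<lambda>A. A \<inter> N A n) ` F))" for n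
    by (rule nowhere_dense_discrete_Union[OF discrete_family_shrink[OF F(1)]])
       (auto intro: nowhere_dense_subset[OF N(1)])
  then have "meagre (\<Union>n. \<Union>((\<lambda>A. A \<inter> N A n) ` F))"
    by (intro meagre_Union) (auto intro: nowhere_dense_imp_meagre)
  moreover have "\<Union>F \<subseteq> (\<Union>n. \<Union>((\<lambda>A. A \<inter> N A n) ` F))"
  proof
    fix x assume "x \<in> \<Union>F"
    then obtain A where A: "A \<in> F" "x \<in> A" by blast
    then obtain n where "x \<in> N A n" using N(2) by blast
    with A show "x \<in> (\<Union>n. \<Union>((\<lambda>A. A \<inter> N A n) ` F))" by blast
  qed
  ultimately show "meagre (\<Union>F)" by (rule meagre_subset)
next
  show "meagre B" if "meagre A" "B \<subseteq> A" for A B :: "'a set"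
    using that by (rule meagre_subset)
  show "meagre (\<Union>F)" if "countable F" "\<forall>A\<in>F. meagre A" for F :: "'a set set"
    using that by (intro meagre_Union) auto
qed

lemma discrete_points_nhd:
  assumes "discrete_family ((\<lambda>x. {x}) ` D)"
  obtains U where "open U" "x \<in> U" "\<And>a b. a \<in> D \<Longrightarrow> b \<in> D \<Longrightarrow> a \<in> U \<Longrightarrow> b \<in> U \<Longrightarrow> a = b"
proof -
  obtain U where U: "open U" "x \<in> U"
    "\<And>A B. A \<in> (\<lambda>x. {x}) ` D \<Longrightarrow> B \<in> (\<lambda>x. {x}) ` D \<Longrightarrow> A \<inter> U \<noteq> {} \<Longrightarrow> B \<inter> U \<noteq> {} \<Longrightarrow> A = B"
    using assms unfolding discrete_family_def by metis
  show thesis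
  proof (rule that[OF U(1,2)])
    fix a b assume "a \<in> D" "b \<in> D" "a \<in> U" "b \<in> U"
    then show "a = b" using U(3)[of "{a}" "{b}"] by auto
  qed
qed

lemma discr_ideal_sigma_discrete: "discr_ideal sigma_discrete_set"
  unfolding discr_ideal_def
proof (intro conjI allI impI)
  fix A B :: "'a set"
  assume "sigma_discrete_set A" "B \<subseteq> A"
  then obtain D :: "nat \<Rightarrow> 'a set" where D: "A = (\<Union>n. D n)"
    "\<And>n. discrete_family ((\<lambda>x. {x}) ` D n)"
    unfolding sigma_discrete_set_def by blast
  show "sigma_discrete_set B"
    unfolding sigma_discrete_set_def
    by (rule exI[of _ "\<lambda>n. B \<inter> D n"])
       (use D \<open>B \<subseteq> A\<close> in \<open>auto intro: discrete_family_subset\<close>)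
next
  fix F :: "'a set set"
  assume F: "countable F" "\<forall>A\<in>F. sigma_discrete_set A"
  then obtain D :: "'a set \<Rightarrow> nat \<Rightarrow> 'a set" where D: "\<And>A. A \<in> F \<Longrightarrow> A = (\<Union>n. D A n)"
    "\<And>A n. A \<in> F \<Longrightarrow> discrete_family ((\<lambda>x. {x}) ` D A n)"
    unfolding sigma_discrete_set_def by metis
  \<comment> \<open>The added empty set keeps \<open>P\<close> nonempty when \<open>F\<close> is
    empty, so that a sequence can enumerate it.\<close>
  define P where "P = insert {} ((\<lambda>(A, n). D A n) ` (F \<times> (UNIV::nat set)))"
  have "countable P" "P \<noteq> {}" using F(1) by (auto simp: P_def)
  then obtain Q :: "nat \<Rightarrow> 'a set" where Q: "range Q = P"
    by (metis uncountable_def)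
  have "discrete_family ((\<lambda>x. {x}) ` S)" if "S \<in> P" for S
    using that D(2) by (auto simp: P_def discrete_family_def)
  then have "\<forall>n. discrete_family ((\<lambda>x. {x}) ` Q n)" using Q by blast
  moreover have "\<Union>F = \<Union>P" using D(1) by (fastforce simp: P_def)
  ultimately show "sigma_discrete_set (\<Union>F)"
    unfolding sigma_discrete_set_def using Q by (intro exI[of _ Q]) auto
next
  fix F :: "'a set set"
  assume F: "discrete_family F" "\<forall>A\<in>F. sigma_discrete_set A"
  then obtain D :: "'a set \<Rightarrow> nat \<Rightarrow> 'a set" where D: "\<And>A. A \<in> F \<Longrightarrow> A = (\<Union>n. D A n)"
    "\<And>A n. A \<in> F \<Longrightarrow> discrete_family ((\<lambda>x. {x}) ` D A n)"
    unfolding sigma_discrete_set_def by metis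
  \<comment> \<open>Layers of equal index are merged across members: one neighbourhood of
    \<open>x\<close> meets at most one member \<open>A\<close>, a second one contains at most one
    point of \<open>D A n\<close>.\<close>
  have "discrete_family ((\<lambda>x. {x}) ` (\<Union>A\<in>F. D A n))" for n
    unfolding discrete_family_def
  proof
    fix x
    obtain U where U: "open U" "x \<in> U"
      "\<And>A B. A \<in> F \<Longrightarrow> B \<in> F \<Longrightarrow> A \<inter> U \<noteq> {} \<Longrightarrow> B \<inter> U \<noteq> {} \<Longrightarrow> A = B"
      using F(1) unfolding discrete_family_def by metis
    show "\<exists>U. open U \<and> x \<in> U \<and> (\<forall>A\<in>(\<lambda>x. {x}) ` (\<Union>A\<in>F. D A n).
            \<forall>B\<in>(\<lambda>x. {x}) ` (\<Union>A\<in>F. D A n). A \<inter> U \<noteq> {} \<and> B \<inter> U \<noteq> {} \<longrightarrow> A = B)"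
    proof (cases "\<exists>A\<in>F. A \<inter> U \<noteq> {}")
      case True
      then obtain A where A: "A \<in> F" "A \<inter> U \<noteq> {}" by blast
      obtain V where V: "open V" "x \<in> V"
        "\<And>a b. a \<in> D A n \<Longrightarrow> b \<in> D A n \<Longrightarrow> a \<in> V \<Longrightarrow> b \<in> V \<Longrightarrow> a = b"
        using discrete_points_nhd[OF D(2)[OF A(1), of n], of x] by metis
      have *: "a \<in> D A n" if "a \<in> U" "B \<in> F" "a \<in> D B n" for a B
        using U(3)[OF that(2) A(1)] A that D(1)[OF that(2)] by blast
      show ?thesis
        by (rule exI[of _ "U \<inter> V"]) (use U V * in auto)
    next
      case False
      then have "a \<notin> U" if "A \<in> F" "a \<in> D A n" for A a
        using D(1)[OF that(1)] that by blast
      then show ?thesis using U(1,2) by (intro exI[of _ U]) auto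
    qed
  qed
  moreover have "\<Union>F = (\<Union>n. \<Union>A\<in>F. D A n)"
  proof (intro equalityI subsetI)
    fix x assume "x \<in> \<Union>F"
    then obtain A where A: "A \<in> F" "x \<in> A" by blast
    then obtain n where "x \<in> D A n" using D(1)[OF A(1)] by auto
    with A show "x \<in> (\<Union>n. \<Union>A\<in>F. D A n)" by blast
  next
    fix x assume "x \<in> (\<Union>n. \<Union>A\<in>F. D A n)"
    then obtain A n where A: "A \<in> F" "x \<in> D A n" by blast
    then have "x \<in> A" using D(1)[OF A(1)] by auto
    with A show "x \<in> \<Union>F" by blast
  qed
  ultimately show "sigma_discrete_set (\<Union>F)"
    unfolding sigma_discrete_set_def by (intro exI[of _ "\<lambda>n. \<Union>A\<in>F. D A n"]) auto
qed

lemma sigma_discrete_set_singleton: "sigma_discrete_set {x}"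
  unfolding sigma_discrete_set_def
  by (rule exI[of _ "\<lambda>_. {x}"]) (auto simp: discrete_family_def)

text \<open>A point outside \<open>D\<close> has a neighbourhood with at most one point of
  \<open>D\<close>, and the T1 axiom allows that point to be deleted.\<close>

lemma closed_discrete_points:
  fixes D :: "'a::t1_space set"
  assumes "discrete_family ((\<lambda>x. {x}) ` D)"
  shows "closed D"
proof -
  have "\<exists>T. open T \<and> x \<in> T \<and> T \<subseteq> - D" if "x \<in> - D" for x
  proof -
    obtain U where U: "open U" "x \<in> U" "\<And>a b. a \<in> D \<Longrightarrow> b \<in> D \<Longrightarrow> a \<in> U \<Longrightarrow> b \<in> U \<Longrightarrow> a = b"
      using discrete_points_nhd[OF assms, of x] by metis
    show ?thesis
    proof (cases "D \<inter> U = {}")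
      case True then show ?thesis using U by blast
    next
      case False
      then obtain a where a: "a \<in> D" "a \<in> U" by blast
      show ?thesis
        by (rule exI[of _ "U - {a}"]) (use U a that in \<open>auto intro: open_delete\<close>)
    qed
  qed
  then have "open (- D)" by (subst open_subopen) blast
  then show ?thesis by (simp add: closed_def)
qed

text \<open>Stone's disjointification along a well-ordering of the family; the members need not be open.\<close>

lemma sigma_discrete_refinement:
  fixes \<U> :: "'a::metric_space set set"
  assumes "\<And>U. U \<in> \<U> \<Longrightarrow> open U"
  obtains S :: "nat \<Rightarrow> 'a set set"
  where "\<And>n. discrete_family (S n)" "\<And>n A. A \<in> S n \<Longrightarrow> \<exists>U\<in>\<U>. A \<subseteq> U" "\<Union>\<U> \<subseteq> (\<Union>n. \<Union>(S n))"
proof -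
  obtain r :: "'a set rel" where r: "well_order_on UNIV r"
    using well_order_on by blast
  then have wf: "wf (r - Id)" and lin: "\<And>a b. a \<noteq> b \<Longrightarrow> (a, b) \<in> r - Id \<or> (b, a) \<in> r - Id"
    unfolding well_order_on_def linear_order_on_def total_on_def by auto
  define T where "T n U = {x \<in> U. ball x (1 / Suc n) \<subseteq> U \<and> (\<forall>V\<in>\<U>. (V, U) \<in> r - Id \<longrightarrow> x \<notin> V)}"
    for n :: nat and U :: "'a set"
  \<comment> \<open>The earlier set \<open>U\<close> contains the ball of radius
    \<open>1 / Suc n\<close> about \<open>x\<close>, whereas \<open>y\<close> avoids
    \<open>U\<close> because \<open>V\<close> comes later; hence the pieces of one level are
    uniformly apart.\<close>
  have far: "dist x y \<ge> 1 / Suc n"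
    if "x \<in> T n U" "y \<in> T n V" "U \<in> \<U>" "V \<in> \<U>" "(U, V) \<in> r - Id" for x y n U V
  proof (rule ccontr)
    assume "\<not> dist x y \<ge> 1 / Suc n"
    then have "y \<in> ball x (1 / Suc n)" by simp
    then have "y \<in> U" using that(1) unfolding T_def by blast
    with that show False unfolding T_def by blast
  qed
  have "discrete_family (T n ` \<U>)" for n
    unfolding discrete_family_def
  proof
    fix x
    have eq: "U = V" if "U \<in> \<U>" "V \<in> \<U>" "y \<in> T n U" "z \<in> T n V" "y \<in> ball x (1 / Suc n / 2)" "z \<in> ball x (1 / Suc n / 2)" for U V y z
    proof (rule ccontr)
      assume "U \<noteq> V"
      then have "dist y z \<ge> 1 / Suc n"
        using lin[of U V] far[of y n U z V] far[of z n V y U] that by (auto simp: dist_commute)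
      moreover have "dist y z < 1 / Suc n / 2 + 1 / Suc n / 2"
        using that(5,6) dist_triangle3[of y z x] unfolding mem_ball by linarith
      ultimately show False by (simp only: field_sum_of_halves)
    qed
    show "\<exists>U. open U \<and> x \<in> U \<and> (\<forall>A\<in>T n ` \<U>. \<forall>B\<in>T n ` \<U>. A \<inter> U \<noteq> {} \<and> B \<inter> U \<noteq> {} \<longrightarrow> A = B)"
      by (rule exI[of _ "ball x (1 / Suc n / 2)"]) (auto dest: eq)
  qed
  moreover have "\<Union>\<U> \<subseteq> (\<Union>n. \<Union>(T n ` \<U>))"
  proof
    fix x assume "x \<in> \<Union>\<U>"
    then obtain U0 where U0: "U0 \<in> {U \<in> \<U>. x \<in> U}" by blast
    \<comment> \<open>The first set of the well-ordering that contains \<open>x\<close> is the one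
      whose piece catches \<open>x\<close>.\<close>
    obtain U where "U \<in> {U \<in> \<U>. x \<in> U}"
      "\<And>V. (V, U) \<in> r - Id \<Longrightarrow> V \<notin> {U \<in> \<U>. x \<in> U}"
      using wfE_min[OF wf U0] by metis
    then have U: "U \<in> \<U>" "x \<in> U" "\<And>V. (V, U) \<in> r - Id \<Longrightarrow> \<not> (V \<in> \<U> \<and> x \<in> V)"
      by auto
    obtain d where "d > 0" "ball x d \<subseteq> U" using assms U open_contains_ball by blast
    moreover obtain n where "1 / Suc n < d" using \<open>d > 0\<close> nat_approx_posE by metis
    ultimately have "ball x (1 / Suc n) \<subseteq> U" by (force simp: subset_iff)
    with U have "x \<in> T n U" unfolding T_def by blast
    with U show "x \<in> (\<Union>n. \<Union>(T n ` \<U>))" by blast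
  qed
  moreover have "\<exists>U\<in>\<U>. A \<subseteq> U" if "A \<in> T n ` \<U>" for n A
    using that unfolding T_def by blast
  ultimately show thesis using that[of "\<lambda>n. T n ` \<U>"] by blast
qed

text \<open>The cover is refined to countably many discrete layers. Within a layer the images have a
  sigma-discrete base whose relevant members lie inside small images, so the discrete-union property
  of \<open>I\<close> reunites them. Smallness of an image thus becomes a local property of the
  source.\<close>

lemma base_sigma_discrete_localize:
  fixes f :: "'a::metric_space \<Rightarrow> 'b::topological_space"
  assumes I: "discr_ideal I" and f: "base_sigma_discrete f"
    and op: "\<And>U. U \<in> \<U> \<Longrightarrow> open U" and small: "\<And>U. U \<in> \<U> \<Longrightarrow> I (f ` (A \<inter> U))"
    and A: "A \<subseteq> \<Union>\<U>"
  shows "I (f ` A)"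
proof -
  obtain S :: "nat \<Rightarrow> 'a set set"
    where S: "\<And>n. discrete_family (S n)" "\<And>n B. B \<in> S n \<Longrightarrow> \<exists>U\<in>\<U>. B \<subseteq> U" "\<Union>\<U> \<subseteq> (\<Union>n. \<Union>(S n))"
    using sigma_discrete_refinement[OF op] by metis
  have "I (\<Union>B\<in>S n. f ` (A \<inter> B))" for n
  proof -
    let ?E = "(\<lambda>B. A \<inter> B) ` S n"
    have "discrete_family ?E" by (rule discrete_family_shrink[OF S(1)]) auto
    then obtain \<B> where \<B>: "sigma_discrete \<B>" "base_for \<B> ((\<lambda>S. f ` S) ` ?E)"
      using f unfolding base_sigma_discrete_def by blast
    then obtain Fs :: "nat \<Rightarrow> 'b set set" where Fs: "\<B> = (\<Union>k. Fs k)" "\<And>k. discrete_family (Fs k)"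
      unfolding sigma_discrete_def by blast
    \<comment> \<open>The base may contain sets that lie in no image of a piece of this layer; those
      are discarded.\<close>
    define Gs where "Gs k = {B \<in> Fs k. \<exists>C\<in>S n. B \<subseteq> f ` (A \<inter> C)}" for k
    have sm: "I (f ` (A \<inter> C))" if "C \<in> S n" for C
    proof -
      obtain U where "U \<in> \<U>" "C \<subseteq> U" using S(2) \<open>C \<in> S n\<close> by blast
      then show ?thesis by (intro discr_idealD(1)[OF I small[of U]]) auto
    qed
    have "I (\<Union>(Gs k))" for k
    proof (rule discr_idealD(3)[OF I discrete_family_subset[OF Fs(2)]])
      show "Gs k \<subseteq> Fs k" unfolding Gs_def by blast
      show "I B" if "B \<in> Gs k" for B
        using that sm discr_idealD(1)[OF I] unfolding Gs_def by blast
    qed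
    then have "I (\<Union>k. \<Union>(Gs k))" by (rule discr_ideal_UN[OF I])
    moreover have "(\<Union>B\<in>S n. f ` (A \<inter> B)) \<subseteq> (\<Union>k. \<Union>(Gs k))"
    proof clarify
      fix C x assume C: "C \<in> S n" "x \<in> A" "x \<in> C"
      then have "f ` (A \<inter> C) \<in> (\<lambda>S. f ` S) ` ?E" by blast
      then obtain B' where B': "B' \<subseteq> \<B>" "f ` (A \<inter> C) = \<Union>B'"
        using \<B>(2) unfolding base_for_def by metis
      moreover have "f x \<in> f ` (A \<inter> C)" using C by blast
      ultimately obtain B where B: "B \<in> \<B>" "f x \<in> B" "B \<subseteq> f ` (A \<inter> C)" by auto
      then show "f x \<in> (\<Union>k. \<Union>(Gs k))" using Fs(1) C unfolding Gs_def by blast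
    qed
    ultimately show ?thesis by (rule discr_idealD(1)[OF I])
  qed
  then have "I (\<Union>n. \<Union>B\<in>S n. f ` (A \<inter> B))" by (rule discr_ideal_UN[OF I])
  moreover have "f ` A \<subseteq> (\<Union>n. \<Union>B\<in>S n. f ` (A \<inter> B))"
  proof
    fix y assume "y \<in> f ` A"
    then obtain x where x: "x \<in> A" "y = f x" by blast
    then have "x \<in> (\<Union>n. \<Union>(S n))" using A S(3) by blast
    with x show "y \<in> (\<Union>n. \<Union>B\<in>S n. f ` (A \<inter> B))" by blast
  qed
  ultimately show ?thesis by (rule discr_idealD(1)[OF I])
qed

section \<open>Separable sets and Cantor sets\<close>

text \<open>Separability of \<open>Y\<close>, phrased with a countable set that may lie outside
  \<open>Y\<close>; in this form it passes to subsets at once.\<close>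

definition countable_closure :: "'a::topological_space set \<Rightarrow> bool" where
  "countable_closure Y \<longleftrightarrow> (\<exists>C. countable C \<and> Y \<subseteq> closure C)"

text \<open>Each member that meets \<open>Y\<close> is the only one meeting some small ball about
  one of countably many centres, so it can be recovered from centre and radius; this is what
  \<open>G\<close> does.\<close>

lemma discrete_family_countable_meet:
  fixes F :: "'a::metric_space set set"
  assumes F: "discrete_family F" and Y: "countable_closure Y"
  shows "countable {A \<in> F. A \<inter> Y \<noteq> {}}"
proof -
  obtain C where C: "countable C" "Y \<subseteq> closure C"
    using Y unfolding countable_closure_def by blast
  define G where "G = (\<lambda>(c, n::nat). THE A. A \<in> F \<and> A \<inter> ball c (1 / Suc n) \<noteq> {})"
  have "{A \<in> F. A \<inter> Y \<noteq> {}} \<subseteq> G ` (C \<times> UNIV)"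
  proof
    fix A assume "A \<in> {A \<in> F. A \<inter> Y \<noteq> {}}"
    then obtain y where A: "A \<in> F" and y: "y \<in> A" "y \<in> Y" by blast
    obtain U where U: "open U" "y \<in> U"
      "\<And>A B. A \<in> F \<Longrightarrow> B \<in> F \<Longrightarrow> A \<inter> U \<noteq> {} \<Longrightarrow> B \<inter> U \<noteq> {} \<Longrightarrow> A = B"
      using discrete_family_nhd[OF F] by metis
    obtain d where d: "d > 0" "ball y d \<subseteq> U" using U(1,2) open_contains_ball by blast
    obtain n where n: "1 / Suc n < d / 2" using d(1) nat_approx_posE[of "d/2"] by auto
    obtain c where c: "c \<in> C" "dist c y < 1 / Suc n"
      using C(2) y(2) closure_approachable[of y C] by (meson of_nat_0_less_iff subsetD zero_less_Suc zero_less_divide_1_iff)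
    have "ball c (1 / Suc n) \<subseteq> ball y d"
    proof
      fix z assume "z \<in> ball c (1 / Suc n)"
      then show "z \<in> ball y d"
        using c(2) n dist_triangle[of y z c] by (simp add: dist_commute)
    qed
    then have sub: "ball c (1 / Suc n) \<subseteq> U" using d(2) by blast
    have "y \<in> A \<inter> ball c (1 / Suc n)" using y c(2) by simp
    then have ne: "A \<inter> ball c (1 / Suc n) \<noteq> {}" by blast
    have "G (c, n) = A"
      unfolding G_def prod.case
    proof (rule the_equality)
      show "A \<in> F \<and> A \<inter> ball c (1 / Suc n) \<noteq> {}" using A ne by blast
      fix B assume B: "B \<in> F \<and> B \<inter> ball c (1 / Suc n) \<noteq> {}"
      show "B = A" by (rule U(3)) (use A B ne sub in blast)+
    qed
    then show "A \<in> G ` (C \<times> UNIV)" using c(1) by (metis SigmaI UNIV_I imageI)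
  qed
  then show ?thesis using C(1) by (meson countable_SIGMA countable_image countable_subset uncountable_def countableI_type)
qed

lemma sigma_discrete_countable:
  fixes N :: "'a::metric_space set"
  assumes "sigma_discrete_set N" "countable_closure Y"
  shows "countable (N \<inter> Y)"
proof -
  obtain D :: "nat \<Rightarrow> 'a set" where D: "N = (\<Union>n. D n)" "\<And>n. discrete_family ((\<lambda>x. {x}) ` D n)"
    using assms(1) unfolding sigma_discrete_set_def by blast
  have "countable (D n \<inter> Y)" for n
  proof (rule countable_image_inj_on)
    have "(\<lambda>x. {x}) ` (D n \<inter> Y) \<subseteq> {A \<in> (\<lambda>x. {x}) ` D n. A \<inter> Y \<noteq> {}}" by auto
    then show "countable ((\<lambda>x. {x}) ` (D n \<inter> Y))"
      using discrete_family_countable_meet[OF D(2) assms(2)] countable_subset by blast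
  qed simp
  then have "countable (\<Union>n. D n \<inter> Y)" by (intro countable_UN) auto
  moreover have "N \<inter> Y = (\<Union>n. D n \<inter> Y)" using D(1) by blast
  ultimately show ?thesis by (simp only:)
qed

lemma countable_closure_subset: "countable_closure Y \<Longrightarrow> Z \<subseteq> Y \<Longrightarrow> countable_closure Z"
  unfolding countable_closure_def by blast

lemma countable_closure_image:
  assumes "countable_closure Y" "continuous_on UNIV f"
  shows "countable_closure (f ` Y)"
proof -
  obtain C where C: "countable C" "Y \<subseteq> closure C"
    using assms(1) unfolding countable_closure_def by blast
  have "f ` closure C \<subseteq> closure (f ` C)"
    by (rule image_closure_subset[OF continuous_on_subset[OF assms(2)]])
       (auto intro: closure_subset[THEN subsetD])
  then show ?thesis unfolding countable_closure_def using C by (intro exI[of _ "f ` C"]) auto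
qed

lemma compact_countable_dense:
  fixes K :: "'a::metric_space set"
  assumes "compact K"
  obtains C where "countable C" "C \<subseteq> K" "K \<subseteq> closure C"
proof -
  have "\<exists>k. finite k \<and> k \<subseteq> K \<and> K \<subseteq> (\<Union>x\<in>k. ball x (1 / Suc n))" for n
    using seq_compact_imp_totally_bounded[of K] assms compact_imp_seq_compact
    by (metis of_nat_0_less_iff zero_less_Suc zero_less_divide_1_iff)
  then obtain k where k: "\<And>n. finite (k n)" "\<And>n. k n \<subseteq> K" "\<And>n. K \<subseteq> (\<Union>x\<in>k n. ball x (1 / Suc n))"
    by metis
  have "K \<subseteq> closure (\<Union>n. k n)"
  proof
    fix x assume x: "x \<in> K"
    show "x \<in> closure (\<Union>n. k n)"
      unfolding closure_approachable
    proof (intro allI impI)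
      fix e :: real assume "e > 0"
      then obtain n where n: "1 / Suc n < e" using nat_approx_posE by metis
      obtain y where "y \<in> k n" "dist y x < 1 / Suc n" using k(3)[of n] x by auto
      then show "\<exists>y\<in>(\<Union>n. k n). dist y x < e" using n by force
    qed
  qed
  moreover have "countable (\<Union>n. k n)" using k(1) by (simp add: countable_finite)
  ultimately show thesis using that k(2) by blast
qed

lemma compact_countable_closure:
  "compact (K::'a::metric_space set) \<Longrightarrow> countable_closure K"
  unfolding countable_closure_def by (metis compact_countable_dense)

text \<open>What is retained of a Cantor set: compactness gives separability and Baire category, and
  the absence of isolated points then gives uncountability.\<close>

definition perfect_compact :: "'a::metric_space set \<Rightarrow> bool" where
  "perfect_compact K \<longleftrightarrow> compact K \<and> K \<noteq> {} \<and> (\<forall>x\<in>K. \<forall>d>0. \<exists>y\<in>K. y \<noteq> x \<and> dist y x < d)"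

text \<open>The subspace \<open>K\<close> is compact Hausdorff, so Baire category applies to it; the
  traces on \<open>K\<close> of the sets in \<open>F\<close> are relatively closed and cannot all
  have empty interior.\<close>

lemma compact_Baire:
  fixes K :: "'a::metric_space set"
  assumes K: "compact K" and U: "open U" "K \<inter> U \<noteq> {}"
    and F: "countable F" "\<And>A. A \<in> F \<Longrightarrow> closed A" "K \<inter> U \<subseteq> \<Union>F"
  obtains A V where "A \<in> F" "open V" "K \<inter> V \<noteq> {}" "K \<inter> V \<subseteq> A"
proof (rule ccontr)
  assume no: "\<not> thesis"
  note wit = that
  let ?T = "top_of_set K"
  have "compact_space ?T" using K by (simp add: compact_space_subtopology)
  moreover have "Hausdorff_space ?T" by (simp add: Hausdorff_space_subtopology)
  ultimately have "locally_compact_space ?T \<and> regular_space ?T"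
    by (simp add: compact_imp_locally_compact_space compact_Hausdorff_imp_regular_space)
  moreover have "closedin ?T B \<and> ?T interior_of B = {}" if B: "B \<in> (\<inter>) K ` F" for B
  proof -
    obtain A where A: "A \<in> F" "B = K \<inter> A" using B by blast
    have "closedin ?T B" using A F(2) by (simp add: closedin_closed_Int)
    moreover have "?T interior_of B = {}"
    proof (rule ccontr)
      assume "?T interior_of B \<noteq> {}"
      then obtain x where x: "x \<in> ?T interior_of B" by blast
      have "openin ?T (?T interior_of B)" by simp
      then obtain V where V: "open V" "?T interior_of B = K \<inter> V"
        by (metis openin_open)
      have "K \<inter> V \<subseteq> A" using V(2) interior_of_subset[of ?T B] A(2) by blast
      moreover have "K \<inter> V \<noteq> {}" using x V(2) by blast
      ultimately show False using no wit[OF A(1) V(1)] by blast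
    qed
    ultimately show ?thesis by blast
  qed
  ultimately have "?T interior_of \<Union>((\<inter>) K ` F) = {}"
    using F(1) by (intro Baire_category_alt) auto
  moreover have "openin ?T (K \<inter> U)" using U(1) by (simp add: openin_open_Int)
  moreover have "K \<inter> U \<subseteq> \<Union>((\<inter>) K ` F)" using F(3) by blast
  ultimately show False using U(2) interior_of_maximal by (metis subset_empty)
qed

lemma perfect_compact_uncountable:
  assumes "perfect_compact K"
  shows "uncountable K"
proof
  assume cK: "countable K"
  have K: "compact K" "K \<noteq> {}" "\<And>x d. x \<in> K \<Longrightarrow> d > 0 \<Longrightarrow> \<exists>y\<in>K. y \<noteq> x \<and> dist y x < d"
    using assms unfolding perfect_compact_def by blast+
  obtain A V where AV: "A \<in> (\<lambda>x. {x}) ` K" "open V" "K \<inter> V \<noteq> {}" "K \<inter> V \<subseteq> A"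
    by (rule compact_Baire[OF K(1) open_UNIV, of "(\<lambda>x. {x}) ` K"]) (use K cK in auto)
  then obtain x where x: "x \<in> K" "x \<in> V" "K \<inter> V \<subseteq> {x}" by blast
  obtain d where "d > 0" "ball x d \<subseteq> V" using AV(2) x(2) open_contains_ball by blast
  moreover obtain y where "y \<in> K" "y \<noteq> x" "dist y x < d" using K(3)[OF x(1) \<open>d > 0\<close>] by blast
  ultimately show False using x(3) by (auto simp: dist_commute)
qed

text \<open>The points of \<open>C\<close> enter the closed cover as singletons. No nonempty
  relatively open part of \<open>K\<close> fits into a singleton, so the Baire argument must select
  a member of \<open>F\<close>.\<close>

lemma perfect_compact_Baire:
  assumes K: "perfect_compact K" and U: "open U" "K \<inter> U \<noteq> {}"
    and C: "countable C" and F: "countable F" "\<And>A. A \<in> F \<Longrightarrow> closed A" and cov: "K \<inter> U \<subseteq> C \<union> \<Union>F"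
  obtains A V where "A \<in> F" "open V" "K \<inter> V \<noteq> {}" "K \<inter> V \<subseteq> A"
proof -
  have K': "compact K" "\<And>x d. x \<in> K \<Longrightarrow> d > 0 \<Longrightarrow> \<exists>y\<in>K. y \<noteq> x \<and> dist y x < d"
    using K unfolding perfect_compact_def by blast+
  obtain A V where AV: "A \<in> (\<lambda>x. {x}) ` C \<union> F" "open V" "K \<inter> V \<noteq> {}" "K \<inter> V \<subseteq> A"
    by (rule compact_Baire[OF K'(1) U, of "(\<lambda>x. {x}) ` C \<union> F"]) (use C F cov in auto)
  have "A \<in> F"
  proof (rule ccontr)
    assume "A \<notin> F"
    then obtain x where x: "x \<in> K" "x \<in> V" "K \<inter> V \<subseteq> {x}" using AV by blast
    obtain d where "d > 0" "ball x d \<subseteq> V" using AV(2) x(2) open_contains_ball by blast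
    moreover obtain y where "y \<in> K" "y \<noteq> x" "dist y x < d" using K'(2)[OF x(1) \<open>d > 0\<close>] by blast
    ultimately show False using x(3) by (auto simp: dist_commute)
  qed
  then show thesis using that AV by blast
qed

section \<open>Uncountable selections and separated sets\<close>

lemma injective_selection:
  assumes J: "uncountable J" and N: "\<And>g. g \<in> J \<Longrightarrow> uncountable (N g)"
  obtains J' \<nu> where "J' \<subseteq> J" "uncountable J'" "inj_on \<nu> J'" "\<And>g. g \<in> J' \<Longrightarrow> \<nu> g \<in> N g"
proof -
  define P where "P = {R. R \<subseteq> Sigma J N \<and> inj_on fst R \<and> inj_on snd R}"
  have "\<exists>M\<in>P. \<forall>X\<in>P. M \<subseteq> X \<longrightarrow> X = M"
  proof (rule subset_Zorn_nonempty)
    show "P \<noteq> {}" unfolding P_def by (auto intro!: exI[of _ "{}"])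
    fix \<C> assume \<C>: "\<C> \<noteq> {}" "subset.chain P \<C>"
    have inj: "inj_on h (\<Union>\<C>)" if "\<And>R. R \<in> P \<Longrightarrow> inj_on h R" for h :: "_ \<times> _ \<Rightarrow> 'c"
    proof (rule inj_onI)
      fix a b assume ab: "a \<in> \<Union>\<C>" "b \<in> \<Union>\<C>" "h a = h b"
      then obtain A B where AB: "A \<in> \<C>" "B \<in> \<C>" "a \<in> A" "b \<in> B" by blast
      then have "A \<subseteq> B \<or> B \<subseteq> A" "A \<in> P" "B \<in> P"
        using \<C>(2) unfolding subset.chain_def by auto
      then obtain D where "D \<in> P" "a \<in> D" "b \<in> D" using AB by blast
      then show "a = b" using that ab(3) by (meson inj_onD)
    qed
    have "\<Union>\<C> \<subseteq> Sigma J N" using \<C>(2) unfolding subset.chain_def P_def by blast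
    moreover have "inj_on fst (\<Union>\<C>)" "inj_on snd (\<Union>\<C>)"
      by (rule inj, simp add: P_def)+
    ultimately show "\<Union>\<C> \<in> P" unfolding P_def by blast
  qed
  then obtain M where "M \<in> P" and max: "\<And>X. X \<in> P \<Longrightarrow> M \<subseteq> X \<Longrightarrow> X = M" by blast
  then have M: "M \<subseteq> Sigma J N" "inj_on fst M" "inj_on snd M"
    unfolding P_def by blast+
  have "uncountable M"
  proof
    assume "countable M"
    then have "countable (fst ` M)" "countable (snd ` M)" by simp_all
    then obtain g where g: "g \<in> J" "g \<notin> fst ` M" using J
      by (meson countable_subset subsetI)
    obtain y where y: "y \<in> N g" "y \<notin> snd ` M"
      using N[OF g(1)] \<open>countable (snd ` M)\<close> by (meson countable_subset subsetI)
    have "insert (g, y) M \<in> P" unfolding P_def using M g y by auto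
    then have "(g, y) \<in> M" using max by blast
    then show False using g(2) by force
  qed
  then have "uncountable (fst ` M)" using M(2) countable_image_inj_on by blast
  define \<nu> where "\<nu> g = snd (THE p. p \<in> M \<and> fst p = g)" for g
  have \<nu>: "(g, \<nu> g) \<in> M" if g: "g \<in> fst ` M" for g
  proof -
    obtain y where y: "(g, y) \<in> M" using g by force
    have "(THE p. p \<in> M \<and> fst p = g) = (g, y)"
    proof (rule the_equality)
      fix p assume "p \<in> M \<and> fst p = g"
      then show "p = (g, y)" by (intro inj_onD[OF M(2)]) (use y in simp_all)
    qed (use y in simp)
    then show ?thesis using y unfolding \<nu>_def by simp
  qed
  have "inj_on \<nu> (fst ` M)"
  proof (rule inj_onI)
    fix a b assume ab: "a \<in> fst ` M" "b \<in> fst ` M" "\<nu> a = \<nu> b"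
    show "a = b"
      using inj_onD[OF M(3) _ \<nu>[OF ab(1)] \<nu>[OF ab(2)]] ab(3) by simp
  qed
  moreover have "fst ` M \<subseteq> J" using M(1) by auto
  moreover have "\<nu> g \<in> N g" if "g \<in> fst ` M" for g using \<nu>[OF that] M(1) by auto
  ultimately show thesis using that \<open>uncountable (fst ` M)\<close> by blast
qed

lemma separated_net:
  fixes A :: "'a::metric_space set"
  assumes "r > 0"
  obtains J where "J \<subseteq> A" "\<And>x y. x \<in> J \<Longrightarrow> y \<in> J \<Longrightarrow> x \<noteq> y \<Longrightarrow> dist x y \<ge> r" "A \<subseteq> (\<Union>x\<in>J. ball x r)"
proof -
  define P where "P = {J. J \<subseteq> A \<and> (\<forall>x\<in>J. \<forall>y\<in>J. x \<noteq> y \<longrightarrow> dist x y \<ge> r)}"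
  have "\<exists>M\<in>P. \<forall>X\<in>P. M \<subseteq> X \<longrightarrow> X = M"
  proof (rule subset_Zorn_nonempty)
    show "P \<noteq> {}" unfolding P_def by (auto intro!: exI[of _ "{}"])
    fix \<C> assume \<C>: "\<C> \<noteq> {}" "subset.chain P \<C>"
    have "dist x y \<ge> r" if xy: "x \<in> \<Union>\<C>" "y \<in> \<Union>\<C>" "x \<noteq> y" for x y
    proof -
      obtain A B where AB: "A \<in> \<C>" "B \<in> \<C>" "x \<in> A" "y \<in> B" using xy by blast
      then have "A \<subseteq> B \<or> B \<subseteq> A" "A \<in> P" "B \<in> P"
        using \<C>(2) unfolding subset.chain_def by auto
      then obtain D where "D \<in> P" "x \<in> D" "y \<in> D" using AB by blast
      then show ?thesis using xy(3) unfolding P_def by blast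
    qed
    moreover have "\<Union>\<C> \<subseteq> A" using \<C>(2) unfolding subset.chain_def P_def by blast
    ultimately show "\<Union>\<C> \<in> P" unfolding P_def by blast
  qed
  then obtain J where J: "J \<in> P" and max: "\<And>X. X \<in> P \<Longrightarrow> J \<subseteq> X \<Longrightarrow> X = J" by blast
  have "A \<subseteq> (\<Union>x\<in>J. ball x r)"
  proof
    fix a assume a: "a \<in> A"
    show "a \<in> (\<Union>x\<in>J. ball x r)"
    proof (rule ccontr)
      assume na: "a \<notin> (\<Union>x\<in>J. ball x r)"
      then have "insert a J \<in> P" using J a unfolding P_def by (auto simp: dist_commute not_less)
      then have "a \<in> J" using max by blast
      then show False using na assms by auto
    qed
  qed
  moreover have "J \<subseteq> A" "\<And>x y. x \<in> J \<Longrightarrow> y \<in> J \<Longrightarrow> x \<noteq> y \<Longrightarrow> dist x y \<ge> r"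
    using J unfolding P_def by blast+
  ultimately show thesis by (intro that[of J])
qed

text \<open>If \<open>J\<close> were uncountable, distinct values in \<open>Y\<close> could be
  selected from uncountably many balls. Their preimages are separated, hence form a discrete family
  of singletons, and base-sigma-discreteness would place uncountably many singletons of points of
  the separable set \<open>Y\<close> in countably many discrete families.\<close>

lemma separated_balls_countable:
  fixes f :: "'a::metric_space \<Rightarrow> 'b::metric_space"
  assumes f: "base_sigma_discrete f" and r: "r > 0"
    and J: "\<And>x y. x \<in> J \<Longrightarrow> y \<in> J \<Longrightarrow> x \<noteq> y \<Longrightarrow> dist x y \<ge> 3 * r"
    and Y: "countable_closure Y" and unc: "\<And>g. g \<in> J \<Longrightarrow> uncountable (f ` ball g r \<inter> Y)"
  shows "countable J"
proof (rule ccontr)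
  assume "uncountable J"
  then obtain J' \<nu> where J': "J' \<subseteq> J" "uncountable J'" "inj_on \<nu> J'"
    and \<nu>: "\<And>g. g \<in> J' \<Longrightarrow> \<nu> g \<in> f ` ball g r \<inter> Y"
    using injective_selection[of J "\<lambda>g. f ` ball g r \<inter> Y"] unc by metis
  have "\<exists>k. k \<in> ball g r \<and> f k = \<nu> g" if "g \<in> J'" for g
    using \<nu>[OF that] by (metis IntD1 imageE)
  then obtain k where k: "\<And>g. g \<in> J' \<Longrightarrow> k g \<in> ball g r" "\<And>g. g \<in> J' \<Longrightarrow> f (k g) = \<nu> g"
    by metis
  \<comment> \<open>The points \<open>k a\<close> and \<open>k b\<close> lie within \<open>r\<close>
    of centres at least \<open>3 * r\<close> apart, so no point is closer than \<open>r / 2\<close>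
    to both.\<close>
  have far: "a = b" if "a \<in> J'" "b \<in> J'" "dist x (k a) < r / 2" "dist x (k b) < r / 2" for a b x
  proof (rule ccontr)
    assume "a \<noteq> b"
    then have "3 * r \<le> dist a b" using J J'(1) that by blast
    moreover have "dist a b \<le> dist a (k a) + dist (k a) x + dist x (k b) + dist (k b) b"
      using dist_triangle[of a b x] dist_triangle[of a x "k a"] dist_triangle[of x b "k b"] by linarith
    ultimately show False using k(1)[OF that(1)] k(1)[OF that(2)] that(3,4) r
      by (simp add: dist_commute)
  qed
  have "discrete_family ((\<lambda>g. {k g}) ` J')"
  proof (rule discrete_family_imageI)
    fix x
    show "\<exists>U. open U \<and> x \<in> U \<and>
      (\<forall>a\<in>J'. \<forall>b\<in>J'. {k a} \<inter> U \<noteq> {} \<longrightarrow> {k b} \<inter> U \<noteq> {} \<longrightarrow> {k a} = {k b})"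
      by (rule exI[of _ "ball x (r / 2)"]) (use r in \<open>auto dest: far\<close>)
  qed
  then obtain \<B> where \<B>: "sigma_discrete \<B>" "base_for \<B> ((\<lambda>S. f ` S) ` (\<lambda>g. {k g}) ` J')"
    using f unfolding base_sigma_discrete_def by blast
  then obtain Fs :: "nat \<Rightarrow> 'b set set" where Fs: "\<B> = (\<Union>n. Fs n)" "\<And>n. discrete_family (Fs n)"
    unfolding sigma_discrete_def by blast
  \<comment> \<open>A singleton that is a union of members of \<open>\<B>\<close> is itself a
    member.\<close>
  have "{\<nu> g} \<in> \<B>" if g: "g \<in> J'" for g
  proof -
    have "{\<nu> g} \<in> (\<lambda>S. f ` S) ` (\<lambda>g. {k g}) ` J'"
    proof (rule image_eqI)
      show "{\<nu> g} = f ` {k g}" using k(2)[OF g] by simp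
      show "{k g} \<in> (\<lambda>g. {k g}) ` J'" using g by blast
    qed
    then obtain B' where B': "B' \<subseteq> \<B>" "{\<nu> g} = \<Union>B'"
      using \<B>(2) unfolding base_for_def by metis
    then obtain B where "B \<in> B'" "\<nu> g \<in> B" by blast
    moreover have "B \<subseteq> {\<nu> g}" using B'(2) \<open>B \<in> B'\<close> by blast
    ultimately have "B = {\<nu> g}" by blast
    then show ?thesis using B'(1) \<open>B \<in> B'\<close> by blast
  qed
  then have "(\<lambda>g. {\<nu> g}) ` J' \<subseteq> (\<Union>n. {A \<in> Fs n. A \<inter> Y \<noteq> {}})"
    using Fs(1) \<nu> by fast
  moreover have "countable (\<Union>n. {A \<in> Fs n. A \<inter> Y \<noteq> {}})"
    using discrete_family_countable_meet[OF Fs(2) Y] by blast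
  ultimately have "countable ((\<lambda>g. {\<nu> g}) ` J')" using countable_subset by blast
  moreover have "inj_on (\<lambda>g. {\<nu> g}) J'" using J'(3) unfolding inj_on_def by simp
  ultimately show False using J'(2) countable_image_inj_on by blast
qed

text \<open>A Cantor scheme: each stage keeps a piece of the Souslin representation on which
  the image is still large, and splits it into two pieces with disjoint images.\<close>

lemma cantor_scheme:
  fixes f :: "'a::metric_space \<Rightarrow> 'b::metric_space" and j :: "'a \<Rightarrow> 'c::complete_space"
  assumes an: "analytic_via j" and I: "discr_ideal I" and sing: "\<And>x. I {x}"
    and f: "base_sigma_discrete f" "continuous_on UNIV f"
    and V: "open V" "\<not> I (f ` V)"
  obtains K where "K \<subseteq> V" "perfect_compact K" "inj_on f K"
proof -
  have iso: "\<And>a b. dist (j a) (j b) = dist a b" and "souslin_F (range j)"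
    using an unfolding analytic_via_def by blast+
  then obtain H :: "nat list \<Rightarrow> 'c set" where H: "\<And>s. closed (H s)"
    "range j = (\<Union>i::nat \<Rightarrow> nat. \<Inter>n. H (map i [0..<Suc n]))"
    unfolding souslin_F_def by blast
  \<comment> \<open>The points possessing a Souslin branch that begins with \<open>s\<close>; every
    point of the space has some branch, so \<open>S []\<close> is everything.\<close>
  define S where "S s = {g. \<exists>i::nat \<Rightarrow> nat. map i [0..<length s] = s \<and> (\<forall>n. j g \<in> H (map i [0..<Suc n]))}" for s
  have S_Nil: "S [] = UNIV"
  proof -
    have "\<exists>i::nat \<Rightarrow> nat. \<forall>n. j g \<in> H (map i [0..<Suc n])" for g
    proof -
      have "j g \<in> (\<Union>i::nat \<Rightarrow> nat. \<Inter>n. H (map i [0..<Suc n]))" using rangeI[of j g] H(2) by simp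
      then show ?thesis by simp
    qed
    then show ?thesis unfolding S_def by auto
  qed
  have S_split: "S s \<subseteq> (\<Union>k. S (s @ [k]))" for s
  proof
    fix g assume "g \<in> S s"
    then obtain i :: "nat \<Rightarrow> nat" where i: "map i [0..<length s] = s" "\<forall>n. j g \<in> H (map i [0..<Suc n])"
      unfolding S_def by blast
    then have "g \<in> S (s @ [i (length s)])"
      unfolding S_def by (intro CollectI exI[of _ i]) simp
    then show "g \<in> (\<Union>k. S (s @ [k]))" by blast
  qed
  define big where "big A \<longleftrightarrow> \<not> I (f ` A)" for A
  have big_mono: "big A \<Longrightarrow> A \<subseteq> B \<Longrightarrow> big B" for A B
    unfolding big_def using discr_idealD(1)[OF I] image_mono by metis
  have big_split: "\<exists>k. big (S (s @ [k]) \<inter> B)" if "big (S s \<inter> B)" for s B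
  proof (rule ccontr)
    assume "\<not> ?thesis"
    then have "I (\<Union>k. f ` (S (s @ [k]) \<inter> B))"
      unfolding big_def by (intro discr_ideal_UN[OF I]) blast
    moreover have "f ` (S s \<inter> B) \<subseteq> (\<Union>k. f ` (S (s @ [k]) \<inter> B))"
      using S_split by blast
    ultimately show False using that discr_idealD(1)[OF I] unfolding big_def by blast
  qed
  \<comment> \<open>The points at which \<open>A\<close> is locally big. By localization the other
    points have a small image, so for big \<open>A\<close> the image of \<open>pts A\<close> stays
    outside \<open>I\<close>.\<close>
  define pts where "pts A = {x \<in> A. \<forall>U. open U \<longrightarrow> x \<in> U \<longrightarrow> big (A \<inter> U)}" for A
  have big_pts: "\<not> I (f ` pts A)" if "big A" for A
  proof
    assume "I (f ` pts A)"
    moreover have "I (f ` (A - pts A))"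
    proof (rule base_sigma_discrete_localize[OF I f(1)])
      let ?U = "{U. open U \<and> \<not> big (A \<inter> U)}"
      show "A - pts A \<subseteq> \<Union>?U" unfolding pts_def by blast
      show "I (f ` ((A - pts A) \<inter> U))" if "U \<in> ?U" for U
      proof -
        have "\<not> big (A \<inter> U)" using that by blast
        then have "\<not> big ((A - pts A) \<inter> U)" using big_mono[of "(A - pts A) \<inter> U" "A \<inter> U"] by blast
        then show ?thesis unfolding big_def by blast
      qed
    qed blast
    ultimately have "I (\<Union>{f ` pts A, f ` (A - pts A)})"
      by (intro discr_idealD(2)[OF I]) auto
    then have "I (f ` A)" by (rule discr_idealD(1)[OF I]) blast
    then show False using that unfolding big_def by blast
  qed
  have two_pts: "\<exists>x\<in>pts A. \<exists>y\<in>pts A. f x \<noteq> f y" if "big A" for A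
  proof (rule ccontr)
    assume no: "\<not> ?thesis"
    show False
    proof (cases "pts A = {}")
      case True
      then show ?thesis using big_pts[OF that] discr_idealD(2)[OF I, of "{}"] by simp
    next
      case False
      then obtain x where "x \<in> pts A" by blast
      with no have "f ` pts A \<subseteq> {f x}" by blast
      then show ?thesis using big_pts[OF that] discr_idealD(1)[OF I sing] by blast
    qed
  qed
  \<comment> \<open>A node consists of a prefix, a centre and a radius. Bigness is asked of open
    balls, whereas closed balls are nested so that limits stay inside.\<close>
  define good where "good = (\<lambda>(s, c, r). 0 < r \<and> big (S s \<inter> ball c r))"
  define child where "child \<nu> \<mu> \<longleftrightarrow>
    good \<mu> \<and> (\<exists>k. fst \<mu> = fst \<nu> @ [k]) \<and> cball (fst (snd \<mu>)) (snd (snd \<mu>)) \<subseteq> ball (fst (snd \<nu>)) (snd (snd \<nu>))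
      \<and> snd (snd \<mu>) \<le> snd (snd \<nu>) / 2" for \<nu> \<mu> :: "nat list \<times> 'a \<times> real"
  define bl where "bl \<nu> = cball (fst (snd \<nu>)) (snd (snd \<nu>))" for \<nu> :: "nat list \<times> 'a \<times> real"
  \<comment> \<open>Two locally big points with different images are separated by disjoint open
    sets; continuity yields balls mapped into these, and the countable splitting of
    \<open>S s\<close> supplies the next entry of each prefix.\<close>
  have step: "\<exists>p. child \<nu> (p False) \<and> child \<nu> (p True) \<and> f ` bl (p False) \<inter> f ` bl (p True) = {}"
    if "good \<nu>" for \<nu>
  proof -
    obtain s c r where \<nu>: "\<nu> = (s, c, r)" by (cases \<nu>)
    let ?A = "S s \<inter> ball c r"
    have A: "big ?A" "r > 0" using that unfolding good_def \<nu> by auto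
    obtain x y where xy: "x \<in> pts ?A" "y \<in> pts ?A" "f x \<noteq> f y" using two_pts[OF A(1)] by blast
    obtain X Y where XY: "open X" "open Y" "f x \<in> X" "f y \<in> Y" "X \<inter> Y = {}"
      using hausdorff[OF xy(3)] by blast
    have ch: "\<exists>\<mu>. child \<nu> \<mu> \<and> f ` bl \<mu> \<subseteq> W" if W: "open W" "f z \<in> W" "z \<in> pts ?A" for z W
    proof -
      have "open (f -` W \<inter> ball c r)"
        using W(1) f(2) by (simp add: continuous_on_open_vimage open_Int)
      moreover have "z \<in> f -` W \<inter> ball c r" using W unfolding pts_def by auto
      ultimately obtain d where d: "d > 0" "cball z d \<subseteq> f -` W \<inter> ball c r"
        using open_contains_cball by blast
      define q where "q = min d (r / 2)"
      have q: "0 < q" "q \<le> r / 2" "cball z q \<subseteq> f -` W \<inter> ball c r"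
        using d A(2) subset_cball[of q d z] unfolding q_def by (auto simp: subset_iff)
      have "big (?A \<inter> ball z q)" using W(3) q(1) unfolding pts_def by simp
      then have "big (S s \<inter> (ball c r \<inter> ball z q))" by (simp add: Int_assoc)
      then obtain k where "big (S (s @ [k]) \<inter> (ball c r \<inter> ball z q))" using big_split by blast
      then have "big (S (s @ [k]) \<inter> ball z q)" by (rule big_mono) blast
      then have "child \<nu> (s @ [k], z, q)" unfolding child_def good_def \<nu> using q by auto
      moreover have "f ` bl (s @ [k], z, q) \<subseteq> W" using q(3) unfolding bl_def by auto
      ultimately show ?thesis by blast
    qed
    obtain \<mu> \<mu>' where "child \<nu> \<mu>" "f ` bl \<mu> \<subseteq> X" "child \<nu> \<mu>'" "f ` bl \<mu>' \<subseteq> Y"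
      using ch[OF XY(1,3) xy(1)] ch[OF XY(2,4) xy(2)] by blast
    then show ?thesis using XY(5) by (intro exI[of _ "\<lambda>b. if b then \<mu>' else \<mu>"]) auto
  qed
  obtain st where st: "\<And>\<nu> b. good \<nu> \<Longrightarrow> child \<nu> (st \<nu> b)"
    "\<And>\<nu>. good \<nu> \<Longrightarrow> f ` bl (st \<nu> False) \<inter> f ` bl (st \<nu> True) = {}"
  proof -
    have "\<forall>\<nu>. \<exists>p. good \<nu> \<longrightarrow> child \<nu> (p False) \<and> child \<nu> (p True) \<and> f ` bl (p False) \<inter> f ` bl (p True) = {}"
      using step by blast
    then obtain st where st: "\<And>\<nu>. good \<nu> \<Longrightarrow> child \<nu> (st \<nu> False) \<and> child \<nu> (st \<nu> True)
      \<and> f ` bl (st \<nu> False) \<inter> f ` bl (st \<nu> True) = {}"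
      by metis
    have "child \<nu> (st \<nu> b)" if "good \<nu>" for \<nu> b using st[OF that] by (cases b) auto
    then show ?thesis using that st by blast
  qed
  obtain \<nu>0 where \<nu>0: "good \<nu>0" "fst \<nu>0 = []" "bl \<nu>0 \<subseteq> V"
  proof -
    have "big V" using V(2) unfolding big_def .
    then obtain x where x: "x \<in> pts V" using two_pts by blast
    then have "x \<in> V" unfolding pts_def by simp
    then obtain d where d: "d > 0" "cball x d \<subseteq> V"
      using V(1) open_contains_cball by blast
    have "big (V \<inter> ball x d)" using x d(1) unfolding pts_def by simp
    then have "big (ball x d)" by (rule big_mono) blast
    then show ?thesis using that[of "([], x, d)"] d unfolding good_def bl_def by (simp add: S_Nil)
  qed
  define nd where "nd \<sigma> n = rec_nat \<nu>0 (\<lambda>k \<nu>. st \<nu> (\<sigma> k)) n" for \<sigma> :: "nat \<Rightarrow> bool" and n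
  have nd0: "nd \<sigma> 0 = \<nu>0" and ndS: "nd \<sigma> (Suc n) = st (nd \<sigma> n) (\<sigma> n)" for \<sigma> n
    unfolding nd_def by simp_all
  have nd_good: "good (nd \<sigma> n)" for \<sigma> n
    by (induction n) (use \<nu>0(1) st(1) in \<open>auto simp: nd0 ndS child_def\<close>)
  have nd_child: "child (nd \<sigma> n) (nd \<sigma> (Suc n))" for \<sigma> n
    unfolding ndS by (rule st(1)[OF nd_good])
  have nd_cong: "nd \<sigma> n = nd \<tau> n" if "\<And>i. i < n \<Longrightarrow> \<sigma> i = \<tau> i" for \<sigma> \<tau> n
    using that by (induction n) (auto simp: nd0 ndS)
  define ct where "ct \<sigma> n = fst (snd (nd \<sigma> n))" for \<sigma> n
  define rd where "rd \<sigma> n = snd (snd (nd \<sigma> n))" for \<sigma> n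
  have rd_pos: "rd \<sigma> n > 0" for \<sigma> n
    using nd_good[of \<sigma> n] unfolding good_def rd_def by (auto split: prod.splits)
  have rd_le: "rd \<sigma> n \<le> snd (snd \<nu>0) / 2 ^ n" for \<sigma> n
  proof (induction n)
    case (Suc n)
    have "rd \<sigma> (Suc n) \<le> rd \<sigma> n / 2" using nd_child[of \<sigma> n] unfolding child_def rd_def by blast
    also have "\<dots> \<le> snd (snd \<nu>0) / 2 ^ n / 2" using Suc by (intro divide_right_mono) auto
    finally show ?case by (simp add: mult.commute)
  qed (simp add: rd_def nd0)
  have rd_small: "\<exists>n. rd \<sigma> n < e" if "e > 0" for \<sigma> e
  proof -
    have "(\<lambda>n. snd (snd \<nu>0) / 2 ^ n) \<longlonglongrightarrow> 0" by (rule LIMSEQ_divide_realpow_zero) simp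
    then have "\<forall>\<^sub>F n in sequentially. snd (snd \<nu>0) / 2 ^ n < e"
      using that by (rule order_tendstoD(2))
    then obtain n where "snd (snd \<nu>0) / 2 ^ n < e"
      using eventually_happens'[OF sequentially_bot] by blast
    then show ?thesis using rd_le[of \<sigma> n] by (intro exI[of _ n]) simp
  qed
  have nest: "bl (nd \<sigma> (n + k)) \<subseteq> bl (nd \<sigma> n)" for \<sigma> n k
  proof (induction k)
    case (Suc k)
    have "bl (nd \<sigma> (Suc (n + k))) \<subseteq> ball (ct \<sigma> (n + k)) (rd \<sigma> (n + k))"
      using nd_child[of \<sigma> "n + k"] unfolding child_def bl_def ct_def rd_def by blast
    also have "\<dots> \<subseteq> bl (nd \<sigma> (n + k))" unfolding bl_def ct_def rd_def by auto
    finally show ?case using Suc by simp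
  qed simp
  have "\<exists>g. \<forall>n. g \<in> bl (nd \<sigma> n)" for \<sigma>
  proof -
    have cin: "ct \<sigma> m \<in> bl (nd \<sigma> n)" if "n \<le> m" for m n
    proof -
      have "ct \<sigma> m \<in> bl (nd \<sigma> m)" using rd_pos[of \<sigma> m] unfolding bl_def ct_def rd_def by simp
      then show ?thesis using nest[of \<sigma> n "m - n"] that by auto
    qed
    \<comment> \<open>The centre of a node need not belong to its Souslin piece, so a nearby member
      \<open>g n\<close> is chosen to carry the branch information.\<close>
    have "\<exists>g. g \<in> S (fst (nd \<sigma> n)) \<and> dist (ct \<sigma> n) g < rd \<sigma> n" for n
    proof -
      have "big (S (fst (nd \<sigma> n)) \<inter> ball (ct \<sigma> n) (rd \<sigma> n))"
        using nd_good[of \<sigma> n] unfolding good_def ct_def rd_def by (auto split: prod.splits)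
      then have "S (fst (nd \<sigma> n)) \<inter> ball (ct \<sigma> n) (rd \<sigma> n) \<noteq> {}"
        using discr_idealD(2)[OF I, of "{}"] unfolding big_def by auto
      then show ?thesis by auto
    qed
    then obtain g where g: "\<And>n. g n \<in> S (fst (nd \<sigma> n))" "\<And>n. dist (ct \<sigma> n) (g n) < rd \<sigma> n" by metis
    have "Cauchy (\<lambda>n. j (ct \<sigma> n))"
      unfolding metric_Cauchy_iff2 iso
    proof (intro allI)
      fix q :: nat
      obtain n where n: "rd \<sigma> n < inverse (real (Suc q)) / 2"
        using rd_small[of "inverse (real (Suc q)) / 2"] by auto
      have "dist (ct \<sigma> m) (ct \<sigma> m') < inverse (real (Suc q))" if "m \<ge> n" "m' \<ge> n" for m m'
        using cin[OF that(1)] cin[OF that(2)] n dist_triangle3[of "ct \<sigma> m" "ct \<sigma> m'" "ct \<sigma> n"]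
        unfolding bl_def ct_def[symmetric] rd_def[symmetric] by simp
      then show "\<exists>M. \<forall>m\<ge>M. \<forall>n\<ge>M. dist (ct \<sigma> m) (ct \<sigma> n) < inverse (real (Suc q))" by blast
    qed
    then obtain l where l: "(\<lambda>n. j (ct \<sigma> n)) \<longlonglongrightarrow> l"
      using Cauchy_convergent convergent_def by blast
    have rd0: "(\<lambda>n. rd \<sigma> n) \<longlonglongrightarrow> 0"
    proof (rule tendsto_sandwich[of "\<lambda>_. 0"])
      show "(\<lambda>n. snd (snd \<nu>0) / 2 ^ n) \<longlonglongrightarrow> 0" by (rule LIMSEQ_divide_realpow_zero) simp
      show "\<forall>\<^sub>F n in sequentially. 0 \<le> rd \<sigma> n"
        by (rule always_eventually) (use rd_pos in \<open>auto intro: less_imp_le\<close>)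
      show "\<forall>\<^sub>F n in sequentially. rd \<sigma> n \<le> snd (snd \<nu>0) / 2 ^ n"
        by (rule always_eventually) (use rd_le in auto)
    qed simp
    have dl: "(\<lambda>n. dist (j (ct \<sigma> n)) l) \<longlonglongrightarrow> 0"
      using iffD1[OF tendsto_dist_iff l] .
    have "(\<lambda>n. dist (j (g n)) l) \<longlonglongrightarrow> 0"
    proof (rule tendsto_sandwich[of "\<lambda>_. 0"])
      show "(\<lambda>n. rd \<sigma> n + dist (j (ct \<sigma> n)) l) \<longlonglongrightarrow> 0"
        using tendsto_add[OF rd0 dl] by simp
      have "dist (j (g n)) l \<le> rd \<sigma> n + dist (j (ct \<sigma> n)) l" for n
        using g(2)[of n] dist_triangle[of "j (g n)" l "j (ct \<sigma> n)"] iso[of "g n" "ct \<sigma> n"]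
        by (simp add: dist_commute)
      then show "\<forall>\<^sub>F n in sequentially. dist (j (g n)) l \<le> rd \<sigma> n + dist (j (ct \<sigma> n)) l"
        by (intro always_eventually) blast
    qed simp_all
    then have lg: "(\<lambda>n. j (g n)) \<longlonglongrightarrow> l" by (rule iffD2[OF tendsto_dist_iff])
    have ext: "\<exists>k. fst (nd \<sigma> (Suc n)) = fst (nd \<sigma> n) @ [k]" for n
      using nd_child unfolding child_def by blast
    then obtain i where i: "\<And>n. fst (nd \<sigma> (Suc n)) = fst (nd \<sigma> n) @ [i n]" by metis
    have pre: "fst (nd \<sigma> n) = map i [0..<n]" for n
      by (induction n) (simp_all add: nd0 \<nu>0(2) i)
    \<comment> \<open>Each \<open>g (n + Suc m)\<close> has a branch of its own, but this agrees
      with \<open>i\<close> on the first \<open>n + Suc m\<close> entries, enough to place it in the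
      closed set in question. Thus the limit, found in the completion, returns to the range of
      \<open>j\<close>.\<close>
    have "l \<in> H (map i [0..<Suc m])" for m
    proof (rule closed_sequentially[OF H(1)])
      show "(\<lambda>n. j (g (n + Suc m))) \<longlonglongrightarrow> l" using lg by (rule LIMSEQ_ignore_initial_segment)
      fix n
      obtain i' :: "nat \<Rightarrow> nat" where i': "map i' [0..<n + Suc m] = map i [0..<n + Suc m]"
        "\<And>k. j (g (n + Suc m)) \<in> H (map i' [0..<Suc k])"
        using g(1)[of "n + Suc m"] unfolding S_def pre by auto
      have "i' k = i k" if "k < n + Suc m" for k
        using arg_cong[OF i'(1), of "\<lambda>xs. xs ! k"] that by (simp del: upt_Suc)
      then have eq: "map i' [0..<Suc m] = map i [0..<Suc m]" by (simp del: upt_Suc)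
      show "j (g (n + Suc m)) \<in> H (map i [0..<Suc m])" using i'(2)[of m] unfolding eq .
    qed
    then have "l \<in> range j" unfolding H(2) by blast
    then obtain g0 where g0: "l = j g0" by blast
    have "(\<lambda>n. ct \<sigma> n) \<longlonglongrightarrow> g0"
      by (rule iffD2[OF tendsto_dist_iff]) (use dl in \<open>simp add: g0 iso\<close>)
    moreover have "closed (bl (nd \<sigma> n))" for n unfolding bl_def by simp
    ultimately have "g0 \<in> bl (nd \<sigma> n)" for n
      by (rule Lim_in_closed_set[rotated 3]) (auto intro!: exI[of _ n] cin simp: eventually_sequentially)
    then show ?thesis by blast
  qed
  then obtain \<gamma> where \<gamma>: "\<And>\<sigma> n. \<gamma> \<sigma> \<in> bl (nd \<sigma> n)" by metis
  have close: "dist (\<gamma> \<sigma>) (\<gamma> \<tau>) \<le> 2 * rd \<sigma> n" if "\<And>i. i < n \<Longrightarrow> \<sigma> i = \<tau> i" for \<sigma> \<tau> n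
    using \<gamma>[of \<sigma> n] \<gamma>[of \<tau> n] nd_cong[OF that]
      dist_triangle3[of "\<gamma> \<sigma>" "\<gamma> \<tau>" "ct \<sigma> n"]
    unfolding bl_def rd_def ct_def by auto
  \<comment> \<open>At the first coordinate where the two sequences differ the points enter sibling
    balls, whose images are disjoint.\<close>
  have sep: "f (\<gamma> \<sigma>) \<noteq> f (\<gamma> \<tau>)" if "\<sigma> \<noteq> \<tau>" for \<sigma> \<tau>
  proof -
    define n where "n = (LEAST n. \<sigma> n \<noteq> \<tau> n)"
    have n: "\<sigma> n \<noteq> \<tau> n" "\<And>i. i < n \<Longrightarrow> \<sigma> i = \<tau> i"
      using that LeastI_ex[of "\<lambda>n. \<sigma> n \<noteq> \<tau> n"] not_less_Least unfolding n_def by blast+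
    have "\<gamma> \<sigma> \<in> bl (st (nd \<sigma> n) (\<sigma> n))" "\<gamma> \<tau> \<in> bl (st (nd \<sigma> n) (\<tau> n))"
      using \<gamma>[of \<sigma> "Suc n"] \<gamma>[of \<tau> "Suc n"] nd_cong[of n \<sigma> \<tau>] n(2) unfolding ndS by auto
    moreover have "f ` bl (st (nd \<sigma> n) (\<sigma> n)) \<inter> f ` bl (st (nd \<sigma> n) (\<tau> n)) = {}"
      using st(2)[OF nd_good[of \<sigma> n]] n(1) by (cases "\<sigma> n"; cases "\<tau> n") (auto simp: Int_commute)
    ultimately show ?thesis by (metis disjoint_iff imageI)
  qed
  have "continuous_on UNIV \<gamma>"
    unfolding continuous_on_topological
  proof (intro ballI allI impI)
    fix \<sigma> :: "nat \<Rightarrow> bool" and B assume B: "open B" "\<gamma> \<sigma> \<in> B"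
    obtain e where e: "e > 0" "ball (\<gamma> \<sigma>) e \<subseteq> B" using B open_contains_ball by blast
    obtain n where n: "rd \<sigma> n < e / 2" using rd_small[of "e / 2"] e(1) by auto
    have "open {\<tau>::nat \<Rightarrow> bool. \<forall>i\<in>{..<n}. \<tau> i \<in> {\<sigma> i}}"
      using product_topology_basis'[of "{..<n}" "\<lambda>i. {\<sigma> i}" "\<lambda>i. i"] by (simp add: open_discrete)
    moreover have "\<gamma> \<tau> \<in> B" if "\<tau> \<in> {\<tau>. \<forall>i\<in>{..<n}. \<tau> i \<in> {\<sigma> i}}" for \<tau>
      using close[of n \<sigma> \<tau>] that n e(2) by (force simp: subset_iff)
    ultimately show "\<exists>A. open A \<and> \<sigma> \<in> A \<and> (\<forall>y\<in>UNIV. y \<in> A \<longrightarrow> \<gamma> y \<in> B)"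
      by (intro exI[of _ "{\<tau>. \<forall>i\<in>{..<n}. \<tau> i \<in> {\<sigma> i}}"]) auto
  qed
  moreover have "compact (UNIV :: (nat \<Rightarrow> bool) set)"
  proof -
    have "compact_space (product_topology (\<lambda>_::nat. euclidean :: bool topology) UNIV)"
    proof -
      have "compact_space (euclidean :: bool topology)"
        by (simp add: compact_space_def finite_imp_compact)
      then show ?thesis by (simp add: compact_space_product_topology)
    qed
    then show ?thesis unfolding euclidean_product_topology compact_space_def by simp
  qed
  ultimately have "compact (range \<gamma>)" by (rule compact_continuous_image)
  moreover have "\<exists>y\<in>range \<gamma>. y \<noteq> x \<and> dist y x < d" if x: "x \<in> range \<gamma>" and "d > 0" for x d
  proof -
    obtain \<sigma> where \<sigma>: "x = \<gamma> \<sigma>" using x by blast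
    obtain n where n: "rd \<sigma> n < d / 2" using rd_small[of "d / 2"] \<open>d > 0\<close> by auto
    \<comment> \<open>Flipping one late coordinate keeps all earlier choices: the new point is
      close, and different by \<open>sep\<close>.\<close>
    let ?\<tau> = "\<sigma>(n := \<not> \<sigma> n)"
    have "\<sigma> \<noteq> ?\<tau>" by (metis fun_upd_same)
    then have "\<gamma> ?\<tau> \<noteq> x" using sep[of \<sigma> ?\<tau>] \<sigma> by metis
    moreover have "dist (\<gamma> ?\<tau>) x < d" using close[of n \<sigma> ?\<tau>] n \<sigma> by (simp add: dist_commute)
    ultimately show ?thesis by blast
  qed
  ultimately have "perfect_compact (range \<gamma>)" unfolding perfect_compact_def by blast
  moreover have "inj_on f (range \<gamma>)" using sep unfolding inj_on_def by (metis rangeE)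
  moreover have "range \<gamma> \<subseteq> V" using \<gamma>[of _ 0] \<nu>0(3) unfolding nd0 by blast
  ultimately show thesis using that by blast
qed

section \<open>Category properties of the action\<close>

lemma nowhere_dense_homeo:
  assumes "nowhere_dense A" "continuous_on UNIV f" "continuous_on UNIV f'"
    and inv: "\<And>x. f' (f x) = x" "\<And>y. f (f' y) = y"
  shows "nowhere_dense (f ` A)"
  unfolding nowhere_dense_def
proof (rule ccontr)
  assume "interior (closure (f ` A)) \<noteq> {}"
  then obtain y where y: "y \<in> interior (closure (f ` A))" by blast
  have "closed (f' -` closure A)" by (rule closed_vimage[OF closed_closure assms(3)])
  then have "closure (f ` A) \<subseteq> f' -` closure A"
    by (intro closure_minimal) (use inv closure_subset[of A] in auto)
  then have "f -` interior (closure (f ` A)) \<subseteq> closure A"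
    using interior_subset inv(1) by fastforce
  moreover have "open (f -` interior (closure (f ` A)))"
    using assms(2) by (simp add: continuous_on_open_vimage)
  ultimately have "f -` interior (closure (f ` A)) \<subseteq> interior (closure A)"
    by (simp add: interior_maximal)
  moreover have "f' y \<in> f -` interior (closure (f ` A))" using y inv(2) by simp
  ultimately show False using assms(1) unfolding nowhere_dense_def by blast
qed

lemma meagre_homeo:
  assumes "meagre A" "continuous_on UNIV f" "continuous_on UNIV f'"
    and inv: "\<And>x. f' (f x) = x" "\<And>y. f (f' y) = y"
  shows "meagre (f ` A)"
proof -
  obtain F where F: "countable F" "\<forall>N\<in>F. nowhere_dense N" "A \<subseteq> \<Union>F"
    using assms(1) unfolding meagre_def by blast
  have "\<forall>N\<in>(`) f ` F. nowhere_dense N" using F(2) nowhere_dense_homeo[OF _ assms(2-5)] by blast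
  moreover have "f ` A \<subseteq> \<Union>((`) f ` F)" using F(3) by blast
  ultimately show ?thesis unfolding meagre_def using F(1) by (intro exI[of _ "(`) f ` F"]) simp
qed

lemma closed_interior_if_nonmeagre_cover:
  assumes U: "\<not> meagre U" "U \<subseteq> \<Union>F" and F: "countable F" "\<And>A. A \<in> F \<Longrightarrow> closed A"
  obtains A where "A \<in> F" "interior A \<noteq> {}"
proof -
  have "\<exists>A\<in>F. interior A \<noteq> {}"
  proof (rule ccontr)
    assume "\<not> ?thesis"
    then have "\<forall>A\<in>F. nowhere_dense A" unfolding nowhere_dense_def using F(2) by simp
    then show False using U F(1) unfolding meagre_def by blast
  qed
  then show thesis using that by blast
qed

text \<open>A discrete layer is closed, and an interior point of it would be isolated in the
  space.\<close>

lemma sigma_discrete_imp_meagre: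
  fixes N :: "'a::t1_space set"
  assumes noiso: "\<And>x::'a. \<not> open {x}" and "sigma_discrete_set N"
  shows "meagre N"
proof -
  obtain D :: "nat \<Rightarrow> 'a set" where D: "N = (\<Union>n. D n)" "\<And>n. discrete_family ((\<lambda>x. {x}) ` D n)"
    using assms(2) unfolding sigma_discrete_set_def by blast
  have "nowhere_dense (D n)" for n
    unfolding nowhere_dense_def
  proof (rule ccontr)
    assume "interior (closure (D n)) \<noteq> {}"
    then obtain x where x: "x \<in> interior (D n)"
      using closed_discrete_points[OF D(2)] by auto
    obtain U where U: "open U" "x \<in> U" "\<And>a b. a \<in> D n \<Longrightarrow> b \<in> D n \<Longrightarrow> a \<in> U \<Longrightarrow> b \<in> U \<Longrightarrow> a = b"
      using discrete_points_nhd[OF D(2)] by metis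
    have "U \<inter> interior (D n) = {x}" using U x interior_subset by blast
    moreover have "open (U \<inter> interior (D n))" using U(1) by blast
    ultimately show False using noiso by metis
  qed
  then show ?thesis unfolding D(1) by (intro meagre_Union) (auto intro: nowhere_dense_imp_meagre)
qed

section \<open>Actions of a Baire group with right-invariant metric, and the shift argument\<close>

locale baire_action =
  fixes m :: "'g::metric_space \<Rightarrow> 'g \<Rightarrow> 'g" (infixl "\<odot>" 70)
    and e :: 'g and iv :: "'g \<Rightarrow> 'g"
    and act :: "'g \<Rightarrow> 'x::metric_space \<Rightarrow> 'x" (infixr "\<rhd>" 75)
  assumes assoc: "a \<odot> b \<odot> c = a \<odot> (b \<odot> c)"
    and left_id [simp]: "e \<odot> a = a" and right_id [simp]: "a \<odot> e = a"
    and left_inv [simp]: "iv a \<odot> a = e" and right_inv [simp]: "a \<odot> iv a = e"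
    and dist_right: "dist (a \<odot> g) (b \<odot> g) = dist a b"
    and act_e [simp]: "e \<rhd> x = x" and act_mult: "(a \<odot> b) \<rhd> x = a \<rhd> b \<rhd> x"
    and cont_act: "continuous_on UNIV ((\<rhd>) g)"
    and cont_eval: "continuous_on UNIV (\<lambda>g. g \<rhd> x)"
    and transitive: "\<exists>g. g \<rhd> x = y"
    and baire: "open U \<Longrightarrow> U \<noteq> {} \<Longrightarrow> \<not> meagre (U :: 'g set)"
begin

lemma cancel [simp]: "iv a \<odot> (a \<odot> b) = b" "a \<odot> (iv a \<odot> b) = b"
  by (simp_all flip: assoc)

lemma inv_unique: "a \<odot> b = e \<Longrightarrow> iv a = b"
  by (metis cancel(1) right_id)

lemma inv_mult: "iv (a \<odot> b) = iv b \<odot> iv a"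
  by (rule inv_unique) (simp add: assoc)

lemma act_inv [simp]: "iv a \<rhd> a \<rhd> x = x" "a \<rhd> iv a \<rhd> x = x"
  by (simp_all flip: act_mult)

lemma act_inv_eq: "iv a \<rhd> x = y \<longleftrightarrow> x = a \<rhd> y"
  by (metis act_inv)

text \<open>Right translation by \<open>g\<close> is an isometry taking \<open>e\<close> to
  \<open>g\<close>. With the next three facts, balls about \<open>e\<close> become symmetric
  neighbourhoods whose radii add under products.\<close>

lemma ball_mult: "u \<in> ball e r \<Longrightarrow> u \<odot> g \<in> ball g r"
  using dist_right[of e g u] by simp

lemma ball_div: "h \<in> ball g r \<Longrightarrow> h \<odot> iv g \<in> ball e r"
  using dist_right[of g "iv g" h] by simp

lemma ball_prod: "a \<in> ball e r \<Longrightarrow> b \<in> ball e s \<Longrightarrow> a \<odot> b \<in> ball e (r + s)"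
  using dist_right[of e b a] dist_triangle[of e "a \<odot> b" b] by simp

lemma ball_inv: "a \<in> ball e r \<Longrightarrow> iv a \<in> ball e r"
  using dist_right[of e a "iv a"] by (simp add: dist_commute)

lemma cont_right_mult: "continuous_on UNIV (\<lambda>u. u \<odot> g)"
  unfolding continuous_on_iff by (auto simp: dist_right)

lemma cont_act_eval: "continuous_on UNIV (\<lambda>u. v \<rhd> u \<rhd> x)"
  by (rule continuous_on_compose2[OF cont_act cont_eval]) simp

lemma meagre_right_mult: "meagre A \<Longrightarrow> meagre ((\<lambda>u. u \<odot> g) ` A)"
  by (rule meagre_homeo[OF _ cont_right_mult cont_right_mult[of "iv g"]]) (simp_all add: assoc)

lemma nowhere_dense_act: "nowhere_dense A \<Longrightarrow> nowhere_dense ((\<rhd>) g ` A)"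
  by (rule nowhere_dense_homeo[OF _ cont_act cont_act[of "iv g"]]) simp_all

lemma open_act: "open A \<Longrightarrow> open ((\<rhd>) g ` A)"
proof -
  assume "open A"
  have "(\<rhd>) g ` A = (\<rhd>) (iv g) -` A" by (force simp: image_iff)
  then show ?thesis using \<open>open A\<close> cont_act by (simp add: continuous_on_open_vimage)
qed

definition orb :: "real \<Rightarrow> 'x \<Rightarrow> 'x set" where
  "orb r x = (\<lambda>u. u \<rhd> x) ` ball e r"

text \<open>Writing \<open>u\<close> as \<open>(u \<odot> iv g) \<odot> g\<close> moves a ball about
  \<open>g\<close> to one about \<open>e\<close>. Neighbourhoods of any group element thereby turn
  into small orbits.\<close>

lemma eval_ball: "(\<lambda>u. u \<rhd> x) ` ball g r = orb r (g \<rhd> x)"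
proof (intro equalityI subsetI)
  fix y assume "y \<in> (\<lambda>u. u \<rhd> x) ` ball g r"
  then obtain u where u: "u \<in> ball g r" "y = u \<rhd> x" by blast
  then have "y = (u \<odot> iv g) \<rhd> g \<rhd> x" by (simp add: act_mult)
  then show "y \<in> orb r (g \<rhd> x)" unfolding orb_def using ball_div[OF u(1)] by blast
next
  fix y assume "y \<in> orb r (g \<rhd> x)"
  then obtain u where u: "u \<in> ball e r" "y = u \<rhd> g \<rhd> x" unfolding orb_def by blast
  then have "y = (u \<odot> g) \<rhd> x" by (simp add: act_mult)
  then show "y \<in> (\<lambda>u. u \<rhd> x) ` ball g r" using ball_mult[OF u(1)] by blast
qed

text \<open>If the closed preimage of the closure of a nowhere dense set had interior, it would
  contain a ball about some \<open>g\<close>, and a small orbit of \<open>g \<rhd> x\<close> would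
  be nowhere dense, hence meagre.\<close>

lemma vimage_meagre:
  assumes nm: "\<And>U x. open U \<Longrightarrow> e \<in> U \<Longrightarrow> \<not> meagre ((\<lambda>u. u \<rhd> x) ` U)" and M: "meagre M"
  shows "meagre {g. g \<rhd> x \<in> M}"
proof -
  obtain N :: "nat \<Rightarrow> 'x set" where N: "\<And>n. nowhere_dense (N n)" "M \<subseteq> (\<Union>n. N n)"
    using meagre_seqE[OF M] by metis
  have "nowhere_dense {g. g \<rhd> x \<in> closure (N n)}" for n
    unfolding nowhere_dense_def
  proof (rule ccontr)
    assume ne: "interior (closure {g. g \<rhd> x \<in> closure (N n)}) \<noteq> {}"
    have "closed {g. g \<rhd> x \<in> closure (N n)}"
      using continuous_closed_vimage[of "closure (N n)" "\<lambda>g. g \<rhd> x"] cont_eval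
      by (simp add: vimage_def continuous_on_eq_continuous_at)
    then obtain g where "g \<in> interior {g. g \<rhd> x \<in> closure (N n)}" using ne by auto
    then obtain d where d: "d > 0" "ball g d \<subseteq> {g. g \<rhd> x \<in> closure (N n)}"
      unfolding mem_interior by blast
    then have "orb d (g \<rhd> x) \<subseteq> closure (N n)" unfolding eval_ball[symmetric] by blast
    then have "meagre (orb d (g \<rhd> x))"
      using nowhere_dense_closure[OF N(1)] nowhere_dense_imp_meagre meagre_subset by blast
    then show False using nm[of "ball e d"] d(1) unfolding orb_def by simp
  qed
  then have "meagre (\<Union>n. {g. g \<rhd> x \<in> closure (N n)})"
    by (intro meagre_Union) (auto intro: nowhere_dense_imp_meagre)
  moreover have "{g. g \<rhd> x \<in> M} \<subseteq> (\<Union>n. {g. g \<rhd> x \<in> closure (N n)})"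
    using N(2) closure_subset by blast
  ultimately show ?thesis by (rule meagre_subset)
qed

lemma shift_compact:
  assumes nm: "\<And>U x. open U \<Longrightarrow> e \<in> U \<Longrightarrow> \<not> meagre ((\<lambda>u. u \<rhd> x) ` U)"
    and lim: "xs \<longlonglongrightarrow> x" and hit: "(\<lambda>g. g \<rhd> x) ` qint A \<inter> qint T \<noteq> {}"
  shows "\<exists>\<alpha>\<in>A. \<exists>N::nat. \<alpha> \<rhd> x \<in> T \<and> (\<forall>n>N. \<alpha> \<rhd> xs n \<in> T)"
proof -
  obtain g0 V0 U0 where V0: "open V0" "meagre (V0 - A)" "g0 \<in> V0"
    and U0: "open U0" "meagre (U0 - T)" "g0 \<rhd> x \<in> U0"
    using hit unfolding qint_def by blast
  define W where "W = {g \<in> V0. g \<rhd> x \<in> U0}"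
  have "W = V0 \<inter> (\<lambda>g. g \<rhd> x) -` U0" unfolding W_def by blast
  then have "open W" using V0(1) U0(1) cont_eval by (simp add: continuous_on_open_vimage open_Int)
  moreover have "g0 \<in> W" unfolding W_def using V0 U0 by blast
  ultimately have "\<not> meagre W" using baire by blast
  \<comment> \<open>Only failures inside \<open>U0\<close> count as bad. This allows
    \<open>N\<close> to be chosen after \<open>\<alpha>\<close>, from the convergence of
    \<open>\<alpha> \<rhd> xs n\<close> to a point of \<open>U0\<close>.\<close>
  define bad where "bad = (V0 - A) \<union> {g. g \<rhd> x \<in> U0 - T} \<union> (\<Union>n. {g. g \<rhd> xs n \<in> U0 - T})"
  have "meagre bad"
  proof -
    have "meagre (\<Union>({V0 - A, {g. g \<rhd> x \<in> U0 - T}} \<union> range (\<lambda>n. {g. g \<rhd> xs n \<in> U0 - T})))"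
      by (rule meagre_Union) (use V0(2) vimage_meagre[OF nm U0(2)] in auto)
    then show ?thesis unfolding bad_def by (rule meagre_subset) blast
  qed
  then have "\<not> W \<subseteq> bad" using \<open>\<not> meagre W\<close> meagre_subset by blast
  then obtain \<alpha> where \<alpha>: "\<alpha> \<in> W" "\<alpha> \<notin> bad" by blast
  have "(\<lambda>n. \<alpha> \<rhd> xs n) \<longlonglongrightarrow> \<alpha> \<rhd> x"
    using lim cont_act continuous_on_tendsto_compose[of UNIV "(\<rhd>) \<alpha>" xs x sequentially] by simp
  moreover have "\<alpha> \<rhd> x \<in> U0" using \<alpha>(1) unfolding W_def by blast
  ultimately have "\<forall>\<^sub>F n in sequentially. \<alpha> \<rhd> xs n \<in> U0" using U0(1) topological_tendstoD by blast
  then obtain N where "\<forall>n\<ge>N. \<alpha> \<rhd> xs n \<in> U0" unfolding eventually_sequentially by blast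
  then have "\<forall>n>N. \<alpha> \<rhd> xs n \<in> T" using \<alpha>(2) unfolding bad_def by auto
  moreover have "\<alpha> \<in> A" "\<alpha> \<rhd> x \<in> T" using \<alpha> unfolding W_def bad_def by auto
  ultimately show ?thesis by blast
qed

end

section \<open>Fat points and their stabilizers\<close>

text \<open>Isolated points are excluded so that sigma-discrete subsets of the space are meagre; a
  space with an isolated point is treated directly in the final theorem.\<close>

locale base_sigma_discrete_action = baire_action m e iv act
  for m :: "'g::metric_space \<Rightarrow> 'g \<Rightarrow> 'g" (infixl "\<odot>" 70)
    and e :: 'g and iv :: "'g \<Rightarrow> 'g"
    and act :: "'g \<Rightarrow> 'x::metric_space \<Rightarrow> 'x" (infixr "\<rhd>" 75) +
  fixes j :: "'g \<Rightarrow> 'c::complete_space"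
  assumes analytic: "analytic_via j"
    and base: "base_sigma_discrete (\<lambda>g. g \<rhd> x)"
    and nonmeagre: "\<not> meagre (UNIV :: 'x set)"
    and no_isolated: "\<not> open {x :: 'x}"
begin

text \<open>Evaluation at one point \<open>x\<close> is onto by transitivity, and each
  \<open>g\<close> sent into this set has a ball whose image is a small orbit belonging to
  \<open>I\<close>; so localization applies.\<close>

lemma small_points:
  assumes I: "discr_ideal I"
  shows "I {p. \<exists>r>0. I (orb r p)}"
proof -
  obtain x :: 'x where True by blast
  let ?E = "{p. \<exists>r>0. I (orb r p)}" let ?A = "{g. g \<rhd> x \<in> ?E}"
  have "I ((\<lambda>g. g \<rhd> x) ` ?A)"
  proof (rule base_sigma_discrete_localize[OF I base])
    let ?U = "{ball g r | g r. I (orb r (g \<rhd> x))}"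
    show "open U" if "U \<in> ?U" for U using that by auto
    show "I ((\<lambda>g. g \<rhd> x) ` (?A \<inter> U))" if U: "U \<in> ?U" for U
    proof -
      obtain g r where g: "U = ball g r" "I (orb r (g \<rhd> x))" using U by blast
      show ?thesis by (rule discr_idealD(1)[OF I g(2)]) (use g(1) eval_ball in blast)
    qed
    show "?A \<subseteq> \<Union>?U"
    proof
      fix g assume "g \<in> ?A"
      then obtain r where "r > 0" "I (orb r (g \<rhd> x))" by blast
      then have "g \<in> ball g r" "ball g r \<in> ?U" by auto
      then show "g \<in> \<Union>?U" by blast
    qed
  qed
  moreover have "?E \<subseteq> (\<lambda>g. g \<rhd> x) ` ?A"
  proof
    fix p assume p: "p \<in> ?E"
    obtain g where "g \<rhd> x = p" using transitive by blast
    then show "p \<in> (\<lambda>g. g \<rhd> x) ` ?A" using p by blast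
  qed
  ultimately show ?thesis using discr_idealD(1)[OF I] by blast
qed

definition fat :: "'x set" where
  "fat = {p. \<forall>r>0. \<not> sigma_discrete_set (orb r p)}"

lemma sigma_discrete_compl_fat: "sigma_discrete_set (- fat)"
proof -
  have "- fat = {p. \<exists>r>0. sigma_discrete_set (orb r p)}" unfolding fat_def by blast
  then show ?thesis using small_points[OF discr_ideal_sigma_discrete] by simp
qed

text \<open>The points with some meagre small orbit form a meagre set, which is not the whole space.
  Any other point is fat, since sigma-discrete sets are meagre here.\<close>

lemma nonmeagre_point:
  obtains z where "\<And>r. r > 0 \<Longrightarrow> \<not> meagre (orb r z)" "z \<in> fat"
proof -
  have "{p. \<exists>r>0. meagre (orb r p)} \<noteq> UNIV"
    using small_points[OF discr_ideal_meagre] nonmeagre by metis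
  then obtain z where z: "\<And>r. r > 0 \<Longrightarrow> \<not> meagre (orb r z)" by blast
  moreover have "z \<in> fat"
    unfolding fat_def using z sigma_discrete_imp_meagre[OF no_isolated] by blast
  ultimately show thesis using that by blast
qed

lemma fat_perfect:
  assumes "p \<in> fat" "r > 0"
  obtains K where "K \<subseteq> ball e r" "perfect_compact K" "inj_on (\<lambda>g. g \<rhd> p) K"
proof (rule cantor_scheme[OF analytic discr_ideal_sigma_discrete sigma_discrete_set_singleton
      base[of p] cont_eval open_ball])
  show "\<not> sigma_discrete_set ((\<lambda>g. g \<rhd> p) ` ball e r)"
    using assms unfolding fat_def orb_def by blast
qed (use that in blast)

text \<open>For every \<open>g\<close> in the stabilizer, evaluation maps
  \<open>ball g (r / 3)\<close> onto the same set \<open>orb (r / 3) p\<close>, which contains an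
  injective image of a Cantor set. Hence an \<open>r\<close>-separated net of the stabilizer is
  countable.\<close>

lemma stabilizer_net:
  assumes p: "p \<in> fat" and r: "r > 0"
  obtains \<Sigma> where "countable \<Sigma>" "\<And>s. s \<in> \<Sigma> \<Longrightarrow> s \<rhd> p = p"
    "{g. g \<rhd> p = p} \<subseteq> (\<Union>s\<in>\<Sigma>. ball s r)"
proof -
  obtain J where J: "J \<subseteq> {g. g \<rhd> p = p}" "\<And>x y. x \<in> J \<Longrightarrow> y \<in> J \<Longrightarrow> x \<noteq> y \<Longrightarrow> dist x y \<ge> r"
    "{g. g \<rhd> p = p} \<subseteq> (\<Union>x\<in>J. ball x r)"
    using separated_net[OF r] by metis
  obtain K where K: "K \<subseteq> ball e (r / 3)" "perfect_compact K" "inj_on (\<lambda>g. g \<rhd> p) K"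
    using fat_perfect[OF p, of "r / 3"] r by auto
  let ?Y = "(\<lambda>g. g \<rhd> p) ` K"
  have "countable J"
  proof (rule separated_balls_countable[OF base[of p], of "r / 3"])
    show "countable_closure ?Y"
      using K(2) compact_countable_closure countable_closure_image[OF _ cont_eval]
      unfolding perfect_compact_def by blast
    show "uncountable ((\<lambda>g. g \<rhd> p) ` ball g (r / 3) \<inter> ?Y)" if "g \<in> J" for g
    proof -
      have "g \<rhd> p = p" using J(1) that by blast
      then have "?Y \<subseteq> (\<lambda>g. g \<rhd> p) ` ball g (r / 3)"
        unfolding eval_ball using K(1) unfolding orb_def by auto
      then have "(\<lambda>g. g \<rhd> p) ` ball g (r / 3) \<inter> ?Y = ?Y" by blast
      moreover have "uncountable ?Y"
        using perfect_compact_uncountable[OF K(2)] countable_image_inj_on[OF _ K(3)] by blast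
      ultimately show ?thesis by simp
    qed
  qed (use J(2) r in auto)
  then show thesis using that J(1,3) by blast
qed

lemma stabilizer_countable_closure:
  assumes "p \<in> fat"
  shows "countable_closure {g. g \<rhd> p = p}"
proof -
  have "\<exists>\<Sigma>. countable \<Sigma> \<and> {g. g \<rhd> p = p} \<subseteq> (\<Union>s\<in>\<Sigma>. ball s (1 / Suc n))" for n
  proof (rule stabilizer_net[OF assms, of "1 / Suc n"])
    show "0 < 1 / real (Suc n)" by simp
    fix \<Sigma> assume "countable \<Sigma>" "{g. g \<rhd> p = p} \<subseteq> (\<Union>s\<in>\<Sigma>. ball s (1 / Suc n))"
    then show ?thesis by blast
  qed
  then obtain \<Sigma> where \<Sigma>: "\<And>n. countable (\<Sigma> n)"
    "\<And>n. {g. g \<rhd> p = p} \<subseteq> (\<Union>s\<in>\<Sigma> n. ball s (1 / Suc n))" by metis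
  have "{g. g \<rhd> p = p} \<subseteq> closure (\<Union>n. \<Sigma> n)"
  proof
    fix g assume g: "g \<in> {g. g \<rhd> p = p}"
    show "g \<in> closure (\<Union>n. \<Sigma> n)"
      unfolding closure_approachable
    proof (intro allI impI)
      fix d :: real assume "d > 0"
      then obtain n where n: "1 / Suc n < d" using nat_approx_posE by metis
      obtain s where "s \<in> \<Sigma> n" "g \<in> ball s (1 / Suc n)" using \<Sigma>(2)[of n] g by blast
      then show "\<exists>y\<in>(\<Union>n. \<Sigma> n). dist y g < d" using n by force
    qed
  qed
  moreover have "countable (\<Union>n. \<Sigma> n)" using \<Sigma>(1) by blast
  ultimately show ?thesis unfolding countable_closure_def by blast
qed

lemma closed_eval_vimage: "closed S \<Longrightarrow> closed {u. v \<rhd> u \<rhd> x \<in> S}"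
  using continuous_closed_vimage[of S "\<lambda>u. v \<rhd> u \<rhd> x"] cont_act_eval
  by (simp add: vimage_def continuous_on_eq_continuous_at)

lemma closed_eval_vimage': "closed S \<Longrightarrow> closed {u. u \<rhd> x \<in> S}"
  using closed_eval_vimage[of S e x] by simp

lemma open_eval_vimage: "open S \<Longrightarrow> open {u. v \<rhd> u \<rhd> x \<in> S}"
  using continuous_on_open_vimage[of UNIV "\<lambda>u. v \<rhd> u \<rhd> x"] cont_act_eval
  by (simp add: vimage_def)

text \<open>If the conjugate of a ball were meagre, then so would be the whole group: pieces of small balls have
  images with a \<open>\<sigma>\<close>-discrete base, and the preimage under \<open>u \<mapsto> v \<rhd> u \<rhd> y\<close> of a basic set is covered
  by countably many translates of the conjugated ball because stabilizers are separable.\<close>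

lemma conjugate_ball_nonmeagre:
  assumes free: "\<And>x r. r > 0 \<Longrightarrow> \<exists>u\<in>ball e r. u \<rhd> x \<noteq> x" and r: "r > 0"
  shows "\<not> meagre {u. v \<odot> u \<odot> iv v \<in> ball e r}"
proof
  assume N: "meagre {u. v \<odot> u \<odot> iv v \<in> ball e r}"
  \<comment> \<open>Right multiplication by \<open>iv v \<odot> c\<close> exchanges the trailing
    \<open>iv v\<close> for \<open>iv c\<close>, and right translations preserve meagreness.\<close>
  have N': "meagre {u. v \<odot> u \<odot> iv c \<in> ball e r}" for c
  proof (rule meagre_subset[OF meagre_right_mult[OF N, of "iv v \<odot> c"]])
    show "{u. v \<odot> u \<odot> iv c \<in> ball e r} \<subseteq> (\<lambda>u. u \<odot> (iv v \<odot> c)) ` {u. v \<odot> u \<odot> iv v \<in> ball e r}"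
    proof
      fix u assume "u \<in> {u. v \<odot> u \<odot> iv c \<in> ball e r}"
      then have "u \<odot> iv c \<odot> v \<in> {u. v \<odot> u \<odot> iv v \<in> ball e r}" by (simp add: assoc)
      moreover have "u = u \<odot> iv c \<odot> v \<odot> (iv v \<odot> c)" by (simp add: assoc)
      ultimately show "u \<in> (\<lambda>u. u \<odot> (iv v \<odot> c)) ` {u. v \<odot> u \<odot> iv v \<in> ball e r}" by blast
    qed
  qed
  obtain y :: 'x where True by blast
  \<comment> \<open>The non-fat points form countably many closed discrete sets. If the preimage of
    one had interior, the map would be constant near some \<open>u0\<close>, and a ball about
    \<open>e\<close> would fix \<open>u0 \<rhd> y\<close>, contrary to \<open>free\<close>.\<close>
  have "meagre {u. v \<rhd> u \<rhd> y \<in> - fat}"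
  proof -
    obtain D :: "nat \<Rightarrow> 'x set" where D: "- fat = (\<Union>n. D n)"
      "\<And>n. discrete_family ((\<lambda>x. {x}) ` D n)"
      using sigma_discrete_compl_fat unfolding sigma_discrete_set_def by blast
    have "nowhere_dense {u. v \<rhd> u \<rhd> y \<in> D n}" for n
      unfolding nowhere_dense_def
    proof (rule ccontr)
      let ?S = "{u. v \<rhd> u \<rhd> y \<in> D n}"
      assume "interior (closure ?S) \<noteq> {}"
      moreover have "closed ?S" by (rule closed_eval_vimage[OF closed_discrete_points[OF D(2)]])
      ultimately obtain u0 where u0: "u0 \<in> interior ?S" by auto
      obtain U where U: "open U" "v \<rhd> u0 \<rhd> y \<in> U"
        "\<And>a b. a \<in> D n \<Longrightarrow> b \<in> D n \<Longrightarrow> a \<in> U \<Longrightarrow> b \<in> U \<Longrightarrow> a = b"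
        using discrete_points_nhd[OF D(2)] by metis
      have "open (interior ?S \<inter> {u. v \<rhd> u \<rhd> y \<in> U})" using open_eval_vimage[OF U(1)] by blast
      moreover have "u0 \<in> interior ?S \<inter> {u. v \<rhd> u \<rhd> y \<in> U}" using u0 U(2) by blast
      ultimately obtain d where d: "d > 0" "ball u0 d \<subseteq> interior ?S \<inter> {u. v \<rhd> u \<rhd> y \<in> U}"
        using open_contains_ball by blast
      have fix0: "b \<rhd> u0 \<rhd> y = u0 \<rhd> y" if "b \<in> ball e d" for b
      proof -
        have "b \<odot> u0 \<in> interior ?S \<inter> {u. v \<rhd> u \<rhd> y \<in> U}" using ball_mult[OF that] d(2) by blast
        then have "v \<rhd> (b \<odot> u0) \<rhd> y \<in> D n" "v \<rhd> (b \<odot> u0) \<rhd> y \<in> U"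
          using interior_subset[of ?S] by blast+
        moreover have "v \<rhd> u0 \<rhd> y \<in> D n" using u0 interior_subset[of ?S] by blast
        ultimately have "v \<rhd> (b \<odot> u0) \<rhd> y = v \<rhd> u0 \<rhd> y" using U(2,3) by blast
        then have "iv v \<rhd> v \<rhd> (b \<odot> u0) \<rhd> y = iv v \<rhd> v \<rhd> u0 \<rhd> y" by simp
        then show ?thesis by (simp add: act_mult)
      qed
      then show False using free[OF d(1)] by blast
    qed
    then have "meagre (\<Union>n. {u. v \<rhd> u \<rhd> y \<in> D n})"
      by (intro meagre_Union) (auto intro: nowhere_dense_imp_meagre)
    then show ?thesis unfolding D(1) by (rule meagre_subset) blast
  qed
  moreover have "meagre {u. v \<rhd> u \<rhd> y \<in> fat}"
  proof -
    define \<G> where "\<G> = {g. g \<rhd> y \<in> fat}"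
    \<comment> \<open>The radius \<open>r / 3\<close> leaves room for three errors: two from the
      width of a piece, one from the stabilizer net.\<close>
    define \<U> where "\<U> = range (\<lambda>g::'g. ball g (r / 3))"
    have op: "open U" if "U \<in> \<U>" for U using that unfolding \<U>_def by auto
    obtain S :: "nat \<Rightarrow> 'g set set"
      where S: "\<And>n. discrete_family (S n)" "\<And>n A. A \<in> S n \<Longrightarrow> \<exists>U\<in>\<U>. A \<subseteq> U" "\<Union>\<U> \<subseteq> (\<Union>n. \<Union>(S n))"
      using sigma_discrete_refinement[OF op] by metis
    have "meagre {u. \<exists>A\<in>S n. v \<rhd> u \<rhd> y \<in> (\<lambda>g. g \<rhd> y) ` (A \<inter> \<G>)}" for n
    proof -
      let ?E = "(\<lambda>A. A \<inter> \<G>) ` S n"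
      have "discrete_family ?E" by (rule discrete_family_shrink[OF S(1)]) auto
      then obtain \<B> where \<B>: "sigma_discrete \<B>" "base_for \<B> ((\<lambda>S. (\<lambda>g. g \<rhd> y) ` S) ` ?E)"
        using base[of y] unfolding base_sigma_discrete_def by blast
      then obtain Fs :: "nat \<Rightarrow> 'x set set" where Fs: "\<B> = (\<Union>k. Fs k)" "\<And>k. discrete_family (Fs k)"
        unfolding sigma_discrete_def by blast
      define Gs where "Gs k = {B \<in> Fs k. \<exists>A\<in>S n. B \<subseteq> (\<lambda>g. g \<rhd> y) ` (A \<inter> \<G>)}" for k
      have TB: "meagre {u. v \<rhd> u \<rhd> y \<in> B}" if B: "A \<in> S n" "B \<subseteq> (\<lambda>g. g \<rhd> y) ` (A \<inter> \<G>)" for A B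
      proof (cases "A \<inter> \<G> = {}")
        case True
        then have eq: "{u. v \<rhd> u \<rhd> y \<in> B} = {}" using B(2) by blast
        show ?thesis unfolding eq by (rule nowhere_dense_imp_meagre) (simp add: nowhere_dense_def)
      next
        case False
        then obtain g1 where g1: "g1 \<in> A" "g1 \<in> \<G>" by blast
        obtain g0 where g0: "A \<subseteq> ball g0 (r / 3)" using S(2)[OF B(1)] unfolding \<U>_def by blast
        have "g1 \<rhd> y \<in> fat" using g1(2) unfolding \<G>_def by blast
        then obtain \<Sigma> where \<Sigma>: "countable \<Sigma>" "{g. g \<rhd> g1 \<rhd> y = g1 \<rhd> y} \<subseteq> (\<Union>s\<in>\<Sigma>. ball s (r / 3))"
          using stabilizer_net[of "g1 \<rhd> y" "r / 3"] r by (metis (no_types, lifting) divide_pos_pos zero_less_numeral)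
        have "{u. v \<rhd> u \<rhd> y \<in> B} \<subseteq> (\<Union>s\<in>\<Sigma>. {u. v \<odot> u \<odot> iv (s \<odot> g1) \<in> ball e r})"
        proof
          fix u assume "u \<in> {u. v \<rhd> u \<rhd> y \<in> B}"
          then obtain g where g: "g \<in> A" "v \<rhd> u \<rhd> y = g \<rhd> y" using B(2) by blast
          \<comment> \<open>As \<open>v \<odot> u\<close> and \<open>g\<close> agree on
            \<open>y\<close>, this element stabilizes \<open>g1 \<rhd> y\<close> and so lies near
            some \<open>s\<close>. Then \<open>v \<odot> u \<odot> iv (s \<odot> g1)\<close> is a
            product of two small factors.\<close>
          define t where "t = g1 \<odot> iv g \<odot> v \<odot> u \<odot> iv g1"
          have "t \<rhd> g1 \<rhd> y = g1 \<rhd> y"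
            unfolding t_def by (simp add: act_mult g(2))
          then obtain s where s: "s \<in> \<Sigma>" "t \<in> ball s (r / 3)" using \<Sigma>(2) by blast
          have "g1 \<in> ball g0 (r / 3)" "g \<in> ball g0 (r / 3)" using g0 g(1) g1(1) by blast+
          then have "dist g1 g < 2 * r / 3"
            using dist_triangle3[of g1 g g0] unfolding mem_ball by linarith
          then have "g \<odot> iv g1 \<in> ball e (2 * r / 3)" by (intro ball_div) simp
          then have "(g \<odot> iv g1) \<odot> (t \<odot> iv s) \<in> ball e (2 * r / 3 + r / 3)"
            by (intro ball_prod ball_div[OF s(2)])
          moreover have "(g \<odot> iv g1) \<odot> (t \<odot> iv s) = v \<odot> u \<odot> iv (s \<odot> g1)"
            unfolding t_def by (simp add: assoc inv_mult)
          moreover have "2 * r / 3 + r / 3 = r" by simp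
          ultimately show "u \<in> (\<Union>s\<in>\<Sigma>. {u. v \<odot> u \<odot> iv (s \<odot> g1) \<in> ball e r})" using s(1) by auto
        qed
        moreover have "meagre (\<Union>s\<in>\<Sigma>. {u. v \<odot> u \<odot> iv (s \<odot> g1) \<in> ball e r})"
          by (intro meagre_Union) (use \<Sigma>(1) N' in auto)
        ultimately show ?thesis using meagre_subset by blast
      qed
      \<comment> \<open>Continuity pulls the discrete family \<open>Gs k\<close> back to a discrete
        family of meagre sets, whose union is again meagre.\<close>
      have "meagre (\<Union>((\<lambda>B. (\<lambda>u. v \<rhd> u \<rhd> y) -` B) ` Gs k))" for k
      proof (rule discr_idealD(3)[OF discr_ideal_meagre])
        have "discrete_family (Gs k)"
          by (rule discrete_family_subset[OF Fs(2)[of k]]) (auto simp: Gs_def)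
        then show "discrete_family ((\<lambda>B. (\<lambda>u. v \<rhd> u \<rhd> y) -` B) ` Gs k)"
          by (rule discrete_family_vimage[OF _ cont_act_eval])
        show "meagre Z" if Z: "Z \<in> (\<lambda>B. (\<lambda>u. v \<rhd> u \<rhd> y) -` B) ` Gs k" for Z
        proof -
          obtain B A where "Z = (\<lambda>u. v \<rhd> u \<rhd> y) -` B" "A \<in> S n" "B \<subseteq> (\<lambda>g. g \<rhd> y) ` (A \<inter> \<G>)"
            using Z unfolding Gs_def by blast
          then show ?thesis using TB[of A B] by (simp add: vimage_def)
        qed
      qed
      then have "meagre (\<Union>k. \<Union>((\<lambda>B. (\<lambda>u. v \<rhd> u \<rhd> y) -` B) ` Gs k))"
        by (intro meagre_Union) auto
      moreover have "{u. \<exists>A\<in>S n. v \<rhd> u \<rhd> y \<in> (\<lambda>g. g \<rhd> y) ` (A \<inter> \<G>)}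
          \<subseteq> (\<Union>k. \<Union>((\<lambda>B. (\<lambda>u. v \<rhd> u \<rhd> y) -` B) ` Gs k))"
      proof
        fix u assume "u \<in> {u. \<exists>A\<in>S n. v \<rhd> u \<rhd> y \<in> (\<lambda>g. g \<rhd> y) ` (A \<inter> \<G>)}"
        then obtain A where A: "A \<in> S n" "v \<rhd> u \<rhd> y \<in> (\<lambda>g. g \<rhd> y) ` (A \<inter> \<G>)" by blast
        then have "(\<lambda>g. g \<rhd> y) ` (A \<inter> \<G>) \<in> (\<lambda>S. (\<lambda>g. g \<rhd> y) ` S) ` ?E" by blast
        then obtain B' where B': "B' \<subseteq> \<B>" "(\<lambda>g. g \<rhd> y) ` (A \<inter> \<G>) = \<Union>B'"
          using \<B>(2) unfolding base_for_def by metis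
        then obtain B where B: "B \<in> B'" "v \<rhd> u \<rhd> y \<in> B" using A(2) by auto
        then have "B \<subseteq> (\<lambda>g. g \<rhd> y) ` (A \<inter> \<G>)" using B'(2) by blast
        moreover obtain k where "B \<in> Fs k" using B(1) B'(1) Fs(1) by blast
        ultimately have "B \<in> Gs k" using A(1) unfolding Gs_def by blast
        then show "u \<in> (\<Union>k. \<Union>((\<lambda>B. (\<lambda>u. v \<rhd> u \<rhd> y) -` B) ` Gs k))" using B(2) by blast
      qed
      ultimately show ?thesis using meagre_subset by blast
    qed
    then have "meagre (\<Union>n. {u. \<exists>A\<in>S n. v \<rhd> u \<rhd> y \<in> (\<lambda>g. g \<rhd> y) ` (A \<inter> \<G>)})"
      by (intro meagre_Union) auto
    moreover have "{u. v \<rhd> u \<rhd> y \<in> fat} \<subseteq> (\<Union>n. {u. \<exists>A\<in>S n. v \<rhd> u \<rhd> y \<in> (\<lambda>g. g \<rhd> y) ` (A \<inter> \<G>)})"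
    proof
      fix u assume u: "u \<in> {u. v \<rhd> u \<rhd> y \<in> fat}"
      have "v \<odot> u \<in> ball (v \<odot> u) (r / 3)" using r by simp
      then obtain n A where A: "A \<in> S n" "v \<odot> u \<in> A" using S(3) unfolding \<U>_def by blast
      have "v \<odot> u \<in> \<G>" using u unfolding \<G>_def by (simp add: act_mult)
      then have "v \<rhd> u \<rhd> y \<in> (\<lambda>g. g \<rhd> y) ` (A \<inter> \<G>)"
        using A(2) by (intro image_eqI[of _ _ "v \<odot> u"]) (simp_all add: act_mult)
      then show "u \<in> (\<Union>n. {u. \<exists>A\<in>S n. v \<rhd> u \<rhd> y \<in> (\<lambda>g. g \<rhd> y) ` (A \<inter> \<G>)})" using A(1) by blast
    qed
    ultimately show ?thesis using meagre_subset by blast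
  qed
  ultimately have "meagre (\<Union>{{u. v \<rhd> u \<rhd> y \<in> - fat}, {u. v \<rhd> u \<rhd> y \<in> fat}})"
    by (intro meagre_Union) auto
  then have "meagre (UNIV :: 'g set)" by (rule meagre_subset) auto
  then show False using baire[of UNIV] by simp
qed

text \<open>A Pettis-type argument: the non-meagre conjugate of the half ball is dense near one of
  its own elements \<open>a\<close>. Right translation by \<open>iv a\<close> moves this to
  \<open>e\<close>, and quotients of two such elements lie in the conjugate of the full
  ball.\<close>

lemma conjugate_ball_dense:
  assumes nm: "\<not> meagre {u. v \<odot> u \<odot> iv v \<in> ball e (r / 2)}"
  obtains d where "d > 0" "ball e d \<subseteq> closure {u. v \<odot> u \<odot> iv v \<in> ball e r}"
proof -
  let ?N = "{u. v \<odot> u \<odot> iv v \<in> ball e (r / 2)}" let ?M = "{u. v \<odot> u \<odot> iv v \<in> ball e r}"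
  have "interior (closure ?N) \<noteq> {}" using nm nowhere_dense_imp_meagre unfolding nowhere_dense_def by blast
  then have "interior (closure ?N) \<inter> closure ?N \<noteq> {}" using interior_subset by blast
  then have "interior (closure ?N) \<inter> ?N \<noteq> {}"
    using open_Int_closure_eq_empty[OF open_interior] by blast
  then obtain a where a: "a \<in> interior (closure ?N)" "a \<in> ?N" by blast
  obtain d where d: "d > 0" "ball a d \<subseteq> closure ?N" using a(1) unfolding mem_interior by blast
  have "(\<lambda>u. u \<odot> iv a) ` ?N \<subseteq> ?M"
  proof clarify
    fix n assume n: "v \<odot> n \<odot> iv v \<in> ball e (r / 2)"
    have "(v \<odot> n \<odot> iv v) \<odot> iv (v \<odot> a \<odot> iv v) \<in> ball e (r / 2 + r / 2)"
      by (rule ball_prod[OF n ball_inv]) (use a(2) in blast)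
    moreover have "(v \<odot> n \<odot> iv v) \<odot> iv (v \<odot> a \<odot> iv v) = v \<odot> (n \<odot> iv a) \<odot> iv v"
      by (simp add: assoc inv_mult)
    ultimately show "v \<odot> (n \<odot> iv a) \<odot> iv v \<in> ball e r" by (simp only: field_sum_of_halves)
  qed
  then have cl: "closure ((\<lambda>u. u \<odot> iv a) ` ?N) \<subseteq> closure ?M" by (rule closure_mono)
  have im: "(\<lambda>u. u \<odot> iv a) ` closure ?N \<subseteq> closure ((\<lambda>u. u \<odot> iv a) ` ?N)"
    by (rule image_closure_subset[OF continuous_on_subset[OF cont_right_mult]])
       (auto intro: closure_subset[THEN subsetD])
  have "ball e d \<subseteq> closure ?M"
  proof
    fix b assume "b \<in> ball e d"
    then have "b \<odot> a \<in> closure ?N" using ball_mult[of b d a] d(2) by blast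
    then have "b \<odot> a \<odot> iv a \<in> closure ?M" using im cl by blast
    then show "b \<in> closure ?M" by (simp add: assoc)
  qed
  then show thesis using that d(1) by blast
qed

lemma nonmeagre_orbits_of_free:
  assumes free: "\<And>x r. r > 0 \<Longrightarrow> \<exists>u\<in>ball e r. u \<rhd> x \<noteq> x" and U: "open U" "e \<in> U"
  shows "\<not> meagre ((\<lambda>u. u \<rhd> x) ` U)"
proof
  assume "meagre ((\<lambda>u. u \<rhd> x) ` U)"
  then obtain N :: "nat \<Rightarrow> 'x set" where N: "\<And>n. nowhere_dense (N n)" "(\<lambda>u. u \<rhd> x) ` U \<subseteq> (\<Union>n. N n)"
    using meagre_seqE by metis
  let ?F = "range (\<lambda>n. {u. u \<rhd> x \<in> closure (N n)})"
  have "\<not> meagre U" using baire U by blast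
  \<comment> \<open>Baire category in the group now gives one of these closed preimages interior,
    which makes a small orbit of some point \<open>?w\<close> nowhere dense.\<close>
  moreover have "U \<subseteq> \<Union>?F" using N(2) closure_subset by blast
  ultimately obtain A where A: "A \<in> ?F" "interior A \<noteq> {}"
    by (rule closed_interior_if_nonmeagre_cover) (auto intro: closed_eval_vimage')
  then obtain n u0 where n: "A = {u. u \<rhd> x \<in> closure (N n)}" and u0: "u0 \<in> interior A" by blast
  then obtain r where r: "r > 0" "ball u0 r \<subseteq> {u. u \<rhd> x \<in> closure (N n)}" unfolding mem_interior by blast
  let ?w = "u0 \<rhd> x"
  have "orb r ?w \<subseteq> closure (N n)" unfolding eval_ball[symmetric] using r(2) by blast
  then have w: "nowhere_dense (orb r ?w)" using nowhere_dense_closure[OF N(1)] nowhere_dense_subset by blast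
  obtain z where z: "\<And>r. r > 0 \<Longrightarrow> \<not> meagre (orb r z)" using nonmeagre_point by metis
  obtain v where v: "v \<rhd> z = ?w" using transitive by blast
  let ?M = "{u. v \<odot> u \<odot> iv v \<in> ball e r}"
  obtain d where d: "d > 0" "ball e d \<subseteq> closure ?M"
    using conjugate_ball_dense[OF conjugate_ball_nonmeagre[OF free, of "r / 2" v]] r(1) by auto
  have "(\<lambda>u. u \<rhd> z) ` ?M \<subseteq> (\<rhd>) (iv v) ` orb r ?w"
  proof clarify
    fix u assume "v \<odot> u \<odot> iv v \<in> ball e r"
    then have "(v \<odot> u \<odot> iv v) \<rhd> ?w \<in> orb r ?w" unfolding orb_def by blast
    moreover have "u \<rhd> z = iv v \<rhd> (v \<odot> u \<odot> iv v) \<rhd> ?w"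
      unfolding v[symmetric] by (simp add: act_mult)
    ultimately show "u \<rhd> z \<in> (\<rhd>) (iv v) ` orb r ?w" by blast
  qed
  then have "nowhere_dense ((\<lambda>u. u \<rhd> z) ` ?M)" using nowhere_dense_act[OF w] nowhere_dense_subset by blast
  then have "nowhere_dense (closure ((\<lambda>u. u \<rhd> z) ` ?M))" by (rule nowhere_dense_closure)
  \<comment> \<open>The closure of \<open>?M\<close> contains \<open>ball e d\<close>, so continuity
    forces all of \<open>orb d z\<close> into the nowhere dense closure.\<close>
  moreover have "(\<lambda>u. u \<rhd> z) ` closure ?M \<subseteq> closure ((\<lambda>u. u \<rhd> z) ` ?M)"
    by (rule image_closure_subset[OF continuous_on_subset[OF cont_eval]])
       (auto intro: closure_subset[THEN subsetD])
  then have "orb d z \<subseteq> closure ((\<lambda>u. u \<rhd> z) ` ?M)" unfolding orb_def using d(2) by blast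
  ultimately have "nowhere_dense (orb d z)" using nowhere_dense_subset by blast
  then show False using z[OF d(1)] nowhere_dense_imp_meagre by blast
qed

section \<open>Open stabilizers\<close>

text \<open>If the stabilizer of \<open>i\<close> is open, then \<open>X\<close> is locally separable, because the orbit of \<open>z\<close>
  under it is a translate of an orbit of the conjugate, separable stabilizer of \<open>z\<close>. A Cantor set
  \<open>K\<close> of group elements then shows that only countably many of its cosets carry \<open>z\<close> into a
  separable open set \<open>Y\<close>, and the Baire property of the group makes the stabilizer of \<open>z\<close> open,
  although \<open>z\<close> is fat.\<close>

lemma no_open_stabilizer:
  assumes r0: "r0 > 0"
  shows "\<exists>u\<in>ball e r0. u \<rhd> i \<noteq> i"
proof (rule ccontr)
  assume "\<not> ?thesis"
  then have fix_i: "\<And>u. u \<in> ball e r0 \<Longrightarrow> u \<rhd> i = i" by blast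
  obtain z where z: "\<And>r. r > 0 \<Longrightarrow> \<not> meagre (orb r z)" "z \<in> fat"
    using nonmeagre_point by metis
  obtain a where a: "a \<rhd> z = i" using transitive by blast
  have az: "iv a \<rhd> i = z" using a by (simp add: act_inv_eq)
  have sepW: "countable_closure {w \<rhd> z | w. w \<rhd> i = i}"
  proof -
    have "countable_closure ((\<rhd>) a ` (\<lambda>g. g \<rhd> iv a \<rhd> z) ` {g. g \<rhd> z = z})"
      by (intro countable_closure_image stabilizer_countable_closure z(2) cont_act cont_eval)
    \<comment> \<open>Conjugation by \<open>a\<close> carries the stabilizer of \<open>i\<close> to
      that of the fat point \<open>z\<close>, whose separability is known.\<close>
    moreover have "{w \<rhd> z | w. w \<rhd> i = i} \<subseteq> (\<rhd>) a ` (\<lambda>g. g \<rhd> iv a \<rhd> z) ` {g. g \<rhd> z = z}"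
    proof clarify
      fix w assume w: "w \<rhd> i = i"
      have "(iv a \<odot> w \<odot> a) \<rhd> z = z" by (simp add: act_mult a w az)
      moreover have "w \<rhd> z = a \<rhd> (iv a \<odot> w \<odot> a) \<rhd> iv a \<rhd> z" by (simp add: act_mult)
      ultimately show "w \<rhd> z \<in> (\<rhd>) a ` (\<lambda>g. g \<rhd> iv a \<rhd> z) ` {g. g \<rhd> z = z}" by blast
    qed
    ultimately show ?thesis by (rule countable_closure_subset)
  qed
  \<comment> \<open>The non-meagre set \<open>orb r0 z\<close> lies in the closure of a countable
    set, so that closure has interior; transitivity moves this separable open set to a neighbourhood
    of \<open>i\<close>.\<close>
  obtain Y where Y_open: "open Y" and iY: "i \<in> Y" and Y_sep: "countable_closure Y"
  proof -
    obtain C0 where C0: "countable C0" "{w \<rhd> z | w. w \<rhd> i = i} \<subseteq> closure C0"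
      using sepW unfolding countable_closure_def by blast
    have "orb r0 z \<subseteq> closure C0" unfolding orb_def using fix_i C0(2) by blast
    then have "interior (closure C0) \<noteq> {}"
      using z(1)[OF r0] meagre_subset nowhere_dense_closure nowhere_dense_imp_meagre
      unfolding nowhere_dense_def by (metis closure_closure)
    then obtain q0 where q0: "q0 \<in> interior (closure C0)" by blast
    obtain b where b: "b \<rhd> q0 = i" using transitive by blast
    have "countable_closure (interior (closure C0))"
      unfolding countable_closure_def using C0(1) interior_subset by blast
    then have "countable_closure ((\<rhd>) b ` interior (closure C0))"
      by (rule countable_closure_image[OF _ cont_act])
    moreover have "open ((\<rhd>) b ` interior (closure C0))" by (intro open_act open_interior)
    moreover have "i \<in> (\<rhd>) b ` interior (closure C0)" using b q0 by blast
    ultimately show ?thesis using that by blast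
  qed
  \<comment> \<open>The set \<open>\<Gamma>\<close> represents right cosets of the stabilizer of
    \<open>i\<close>; since this contains \<open>ball e r0\<close>, elements closer than
    \<open>r0\<close> share a coset. Cantor sets inside the separable \<open>Y\<close> make the net
    of representatives countable.\<close>
  obtain \<Gamma> where \<Gamma>: "countable \<Gamma>"
    "\<And>g. g \<rhd> z \<in> Y \<Longrightarrow> g \<rhd> z \<in> fat \<Longrightarrow> \<exists>k\<in>\<Gamma>. (g \<odot> iv k) \<rhd> i = i"
  proof -
    define G where "G = {g. g \<rhd> z \<in> Y \<and> g \<rhd> z \<in> fat}"
    obtain J where J: "J \<subseteq> G" "\<And>x y. x \<in> J \<Longrightarrow> y \<in> J \<Longrightarrow> x \<noteq> y \<Longrightarrow> dist x y \<ge> r0"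
      "G \<subseteq> (\<Union>x\<in>J. ball x r0)" using separated_net[OF r0] by metis
    have "countable J"
    proof (rule separated_balls_countable[OF base[of z], of "r0 / 3"])
      fix g assume "g \<in> J"
      then have g: "g \<rhd> z \<in> Y" "g \<rhd> z \<in> fat" using J(1) unfolding G_def by blast+
      have "open {u. u \<rhd> g \<rhd> z \<in> Y}" using open_eval_vimage[OF Y_open, of e] by simp
      moreover have "e \<in> {u. u \<rhd> g \<rhd> z \<in> Y}" using g(1) by simp
      ultimately obtain d where d: "d > 0" "ball e d \<subseteq> {u. u \<rhd> g \<rhd> z \<in> Y}" by (rule openE)
      obtain K where K: "K \<subseteq> ball e (min d (r0 / 3))" "perfect_compact K" "inj_on (\<lambda>u. u \<rhd> g \<rhd> z) K"
        using fat_perfect[OF g(2), of "min d (r0 / 3)"] d(1) r0 by auto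
      have "(\<lambda>u. u \<rhd> g \<rhd> z) ` K \<subseteq> orb (r0 / 3) (g \<rhd> z) \<inter> Y"
        unfolding orb_def using K(1) d(2) by (auto simp: subset_iff)
      then have "(\<lambda>u. u \<rhd> g \<rhd> z) ` K \<subseteq> (\<lambda>u. u \<rhd> z) ` ball g (r0 / 3) \<inter> Y"
        by (simp only: eval_ball)
      moreover have "uncountable ((\<lambda>u. u \<rhd> g \<rhd> z) ` K)"
        using perfect_compact_uncountable[OF K(2)] countable_image_inj_on[OF _ K(3)] by blast
      ultimately show "uncountable ((\<lambda>u. u \<rhd> z) ` ball g (r0 / 3) \<inter> Y)"
        using countable_subset by blast
    next
      show "dist x y \<ge> 3 * (r0 / 3)" if "x \<in> J" "y \<in> J" "x \<noteq> y" for x y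
        using J(2)[OF that] by simp
    qed (use r0 Y_sep in simp_all)
    moreover have "\<exists>k\<in>J. (g \<odot> iv k) \<rhd> i = i" if g: "g \<rhd> z \<in> Y" "g \<rhd> z \<in> fat" for g
    proof -
      obtain k where "k \<in> J" "g \<in> ball k r0" using J(3) g unfolding G_def by blast
      then show ?thesis using fix_i[OF ball_div] by blast
    qed
    ultimately show ?thesis using that by blast
  qed
  \<comment> \<open>The part of \<open>Y\<close> that the stabilizer of \<open>i\<close> does not
    reach from fat points of \<open>Y\<close>. Taking \<open>w = e\<close> shows that it has no fat
    point, so it is countable.\<close>
  define C where "C = Y - (\<Union>w\<in>{w. w \<rhd> i = i}. (\<rhd>) w ` (Y \<inter> fat))"
  have "C \<subseteq> - fat \<inter> Y"
  proof
    fix c assume c: "c \<in> C"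
    then have "c \<notin> fat" unfolding C_def by (auto dest!: spec[of _ e] simp: image_iff)
    then show "c \<in> - fat \<inter> Y" using c unfolding C_def by blast
  qed
  then have C_countable: "countable C"
    using sigma_discrete_countable[OF sigma_discrete_compl_fat Y_sep] countable_subset by blast
  have cover: "g \<rhd> z \<in> C \<or> (\<exists>k\<in>\<Gamma>. (g \<odot> iv k) \<rhd> i = i)" if gY: "g \<rhd> z \<in> Y" for g
  proof (cases "g \<rhd> z \<in> C")
    case False
    then obtain w q where w: "w \<rhd> i = i" "q \<in> Y" "q \<in> fat" "g \<rhd> z = w \<rhd> q"
      using gY unfolding C_def by blast
    then have "(iv w \<odot> g) \<rhd> z = q" by (simp add: act_mult)
    then obtain k where k: "k \<in> \<Gamma>" "(iv w \<odot> g \<odot> iv k) \<rhd> i = i" using \<Gamma>(2)[of "iv w \<odot> g"] w by blast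
    then have "(g \<odot> iv k) \<rhd> i = w \<rhd> i" by (simp add: act_mult act_inv_eq)
    then show ?thesis using k(1) w(1) by auto
  qed simp
  obtain K where K: "perfect_compact K" "inj_on (\<lambda>g. g \<rhd> z) K"
    using fat_perfect[OF z(2), of 1] by auto
  obtain g0 where g0: "g0 \<in> K" using K(1) unfolding perfect_compact_def by blast
  obtain D where D: "countable D" "D \<subseteq> K" "K \<subseteq> closure D"
    using K(1) compact_countable_dense unfolding perfect_compact_def by metis
  \<comment> \<open>Near \<open>g0\<close> the points \<open>k\<close> of \<open>K\<close> with
    \<open>g \<rhd> k \<rhd> z\<close> in \<open>Y\<close> are covered by a countable set and
    countably many closed conditions \<open>k \<rhd> iv l \<rhd> i = iv g \<rhd> i\<close>. By Baire
    category one condition holds on a relatively open part of \<open>K\<close>, hence at some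
    \<open>k\<close> in the dense set \<open>D\<close>.\<close>
  have sub: "iv g \<rhd> i \<in> (\<lambda>(k, l). k \<rhd> iv l \<rhd> i) ` (D \<times> \<Gamma>)" if g: "g \<rhd> g0 \<rhd> z \<in> Y" for g
  proof -
    let ?U = "{k. g \<rhd> k \<rhd> z \<in> Y}" let ?C = "{k \<in> K. g \<rhd> k \<rhd> z \<in> C}"
    let ?F = "(\<lambda>l. {k. k \<rhd> iv l \<rhd> i \<in> {iv g \<rhd> i}}) ` \<Gamma>"
    have "countable ?C"
    proof (rule countable_image_inj_on)
      have "(\<lambda>k. k \<rhd> z) ` ?C \<subseteq> (\<rhd>) (iv g) ` C"
      proof clarify
        fix k assume "g \<rhd> k \<rhd> z \<in> C"
        then have "iv g \<rhd> g \<rhd> k \<rhd> z \<in> (\<rhd>) (iv g) ` C" by (rule imageI)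
        then show "k \<rhd> z \<in> (\<rhd>) (iv g) ` C" by (simp only: act_inv)
      qed
      then show "countable ((\<lambda>k. k \<rhd> z) ` ?C)"
        by (rule countable_subset) (rule countable_image[OF C_countable])
      show "inj_on (\<lambda>k. k \<rhd> z) ?C" using K(2) by (rule inj_on_subset) blast
    qed
    moreover have "K \<inter> ?U \<subseteq> ?C \<union> \<Union>?F"
    proof
      fix k assume k: "k \<in> K \<inter> ?U"
      then have "(g \<odot> k) \<rhd> z \<in> Y" by (simp add: act_mult)
      then consider "(g \<odot> k) \<rhd> z \<in> C" | l where "l \<in> \<Gamma>" "(g \<odot> k \<odot> iv l) \<rhd> i = i" using cover by blast
      then show "k \<in> ?C \<union> \<Union>?F"
      proof cases
        case 1
        then show ?thesis using k by (simp add: act_mult)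
      next
        case 2
        then have "k \<rhd> iv l \<rhd> i = iv g \<rhd> i" by (metis act_inv(1) act_mult)
        then show ?thesis using 2(1) by blast
      qed
    qed
    moreover have "K \<inter> ?U \<noteq> {}" using g g0 by blast
    moreover have "countable ?F" using \<Gamma>(1) by simp
    moreover have "closed A" if "A \<in> ?F" for A using that closed_eval_vimage'[OF closed_singleton] by blast
    ultimately obtain A V where A: "A \<in> ?F" "open V" "K \<inter> V \<noteq> {}" "K \<inter> V \<subseteq> A"
      using perfect_compact_Baire[OF K(1) open_eval_vimage[OF Y_open, of g z]] by (metis (no_types, lifting))
    obtain l where l: "l \<in> \<Gamma>" "A = {k. k \<rhd> iv l \<rhd> i \<in> {iv g \<rhd> i}}" using A(1) by blast
    have "V \<inter> closure D \<noteq> {}" using A(3) D(3) by blast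
    then obtain k where k: "k \<in> D" "k \<in> V" using open_Int_closure_eq_empty[OF A(2)] by blast
    then have "k \<in> A" using A(4) D(2) by blast
    then show ?thesis using k(1) l by force
  qed
  let ?R = "(\<rhd>) (iv g0) ` (\<lambda>(k, l). k \<rhd> iv l \<rhd> i) ` (D \<times> \<Gamma>)"
  \<comment> \<open>Passing to \<open>g \<odot> iv g0\<close> turns the condition on
    \<open>g0 \<rhd> z\<close> into one on \<open>z\<close>, with the same countable
    \<open>?R\<close> for all \<open>g\<close>.\<close>
  have R: "iv g \<rhd> i \<in> ?R" if "g \<rhd> z \<in> Y" for g
  proof -
    have "iv (g \<odot> iv g0) \<rhd> i \<in> (\<lambda>(k, l). k \<rhd> iv l \<rhd> i) ` (D \<times> \<Gamma>)"
      by (rule sub) (use that in \<open>simp add: act_mult\<close>)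
    moreover have "iv g \<rhd> i = iv g0 \<rhd> iv (g \<odot> iv g0) \<rhd> i" by (simp add: inv_mult act_mult)
    ultimately show ?thesis by blast
  qed
  \<comment> \<open>With \<open>q = iv (a \<odot> u) \<rhd> i\<close> one gets
    \<open>u \<rhd> q = iv a \<rhd> i = z\<close>. So countably many closed sets cover an open set
    of group elements; interior in one of them makes a small orbit of \<open>z\<close> a single
    point.\<close>
  let ?U = "{u. a \<rhd> u \<rhd> z \<in> Y}" let ?F = "(\<lambda>q. {u. u \<rhd> q \<in> {z}}) ` ?R"
  have "open ?U" by (rule open_eval_vimage[OF Y_open])
  moreover have "e \<in> ?U" using iY a by simp
  ultimately have "\<not> meagre ?U" using baire by blast
  moreover have "?U \<subseteq> \<Union>?F"
  proof
    fix u assume "u \<in> ?U"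
    then have "iv (a \<odot> u) \<rhd> i \<in> ?R" by (intro R) (simp add: act_mult)
    moreover have "u \<rhd> iv (a \<odot> u) \<rhd> i = z" by (simp add: inv_mult act_mult az)
    ultimately show "u \<in> \<Union>?F" by blast
  qed
  moreover have "countable ?F" using D(1) \<Gamma>(1) by simp
  moreover have "closed A" if A: "A \<in> ?F" for A
  proof -
    obtain q where "A = {u. u \<rhd> q \<in> {z}}" using A by blast
    then show ?thesis using closed_eval_vimage'[OF closed_singleton] by (simp only:)
  qed
  ultimately obtain A where A: "A \<in> ?F" "interior A \<noteq> {}"
    by (rule closed_interior_if_nonmeagre_cover)
  then obtain q u0 where q: "A = {u. u \<rhd> q \<in> {z}}" and u0: "u0 \<in> interior A" by blast
  then obtain d where d: "d > 0" "ball u0 d \<subseteq> {u. u \<rhd> q \<in> {z}}" unfolding mem_interior by blast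
  have "u0 \<in> ball u0 d" using d(1) by simp
  then have u0z: "u0 \<rhd> q = z" using d(2) by blast
  have "orb d z \<subseteq> {z}"
    unfolding u0z[symmetric] eval_ball[symmetric] using d(2) u0z by auto
  then have "sigma_discrete_set (orb d z)"
    using discr_idealD(1)[OF discr_ideal_sigma_discrete sigma_discrete_set_singleton] by blast
  then show False using z(2) d(1) unfolding fat_def by blast
qed

lemma nonmeagre_orbits:
  "open U \<Longrightarrow> e \<in> U \<Longrightarrow> \<not> meagre ((\<lambda>u. u \<rhd> x) ` U)"
  using nonmeagre_orbits_of_free[OF no_open_stabilizer] by blast

end

section \<open>Discrete spaces and the final theorem\<close>

lemma meagre_isolated:
  assumes "\<And>x::'a::topological_space. open {x}" and "meagre S"
  shows "S = ({}::'a set)"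
proof (rule ccontr)
  assume "S \<noteq> {}"
  then obtain x where "x \<in> S" by blast
  obtain F where F: "\<forall>N\<in>F. nowhere_dense N" "S \<subseteq> \<Union>F"
    using assms(2) unfolding meagre_def by auto
  then obtain N where x: "x \<in> N" "nowhere_dense N" using \<open>x \<in> S\<close> by blast
  have "{x} \<subseteq> interior (closure N)"
    using assms(1) x(1) closure_subset[of N] by (intro interior_maximal) auto
  then show False using x(2) unfolding nowhere_dense_def by blast
qed

theorem theoremS:
  fixes m :: "'g::metric_space \<Rightarrow> 'g \<Rightarrow> 'g" and e :: 'g
    and \<phi> :: "'g \<Rightarrow> 'x::metric_space \<Rightarrow> 'x"
    and T :: "'x set"
    and j :: "'g \<Rightarrow> 'c::complete_space"
  assumes grp: "group \<lparr>carrier = UNIV, mult = m, one = e\<rparr>"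
    and right_inv: "\<forall>a b g. dist (m a g) (m b g) = dist a b"
    and baireG: "baire_space TYPE('g)"
    and T_nm: "\<not> meagre T" and T_bp: "baire_prop T"
    and act: "group_action m e \<phi>"
    and sepc: "sep_continuous_action \<phi>"
    and trans: "transitive_action \<phi>"
  shows "(nikodym_action e \<phi> \<or> (analytic_via j \<and> (\<forall>x. base_sigma_discrete (\<lambda>g. \<phi> g x)))) \<longrightarrow>
    (\<forall>xs x A. xs \<longlonglongrightarrow> x \<longrightarrow> \<not> meagre A \<longrightarrow> baire_prop A \<longrightarrow> e \<in> qint A \<longrightarrow>
        (\<lambda>g. \<phi> g x) ` qint A \<inter> qint T \<noteq> {} \<longrightarrow>
        (\<exists>\<alpha>\<in>A. \<exists>N::nat. \<phi> \<alpha> x \<in> T \<and> (\<forall>n>N. \<phi> \<alpha> (xs n) \<in> T)))"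
proof (intro impI allI)
  assume hyp: "nikodym_action e \<phi> \<or> (analytic_via j \<and> (\<forall>x. base_sigma_discrete (\<lambda>g. \<phi> g x)))"
  fix xs x A
  assume lim: "xs \<longlonglongrightarrow> x" and hit: "(\<lambda>g. \<phi> g x) ` qint A \<inter> qint T \<noteq> {}"
  let ?G = "\<lparr>carrier = UNIV, mult = m, one = e\<rparr>"
  interpret G: group ?G by (rule grp)
  define iv where "iv a = inv\<^bsub>?G\<^esub> a" for a
  interpret baire_action m e iv \<phi>
  proof
    show "m (m a b) c = m a (m b c)" for a b c using G.m_assoc[of a b c] by simp
    show "m e a = a" for a using G.l_one[of a] by simp
    show "m a e = a" for a using G.r_one[of a] by simp
    show "m (iv a) a = e" for a using G.l_inv[of a] by (simp add: iv_def)
    show "m a (iv a) = e" for a using G.r_inv[of a] by (simp add: iv_def)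
    show "dist (m a g) (m b g) = dist a b" for a b g using right_inv by blast
    show "\<phi> e y = y" "\<phi> (m a b) y = \<phi> a (\<phi> b y)" for a b y
      using act unfolding group_action_def by blast+
    show "continuous_on UNIV (\<phi> g)" "continuous_on UNIV (\<lambda>g. \<phi> g y)" for g y
      using sepc unfolding sep_continuous_action_def by blast+
    show "\<exists>g. \<phi> g y = y'" for y y' using trans unfolding transitive_action_def by blast
    show "\<not> meagre U" if "open U" "U \<noteq> {}" for U :: "'g set"
      using baireG that unfolding baire_space_def by blast
  qed
  \<comment> \<open>Both alternative hypotheses enter only through this fact, which is what
    \<open>shift_compact\<close> requires.\<close>
  have nm: "\<not> meagre ((\<lambda>u. \<phi> u y) ` U)" if U: "open U" "e \<in> U" for U y
  proof (cases "nikodym_action e \<phi>")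
    case True
    then show ?thesis using U meagre_subset unfolding nikodym_action_def by blast
  next
    case False
    then have an: "analytic_via j" "\<And>x. base_sigma_discrete (\<lambda>g. \<phi> g x)" using hyp by blast+
    show ?thesis
    proof (cases "\<exists>p::'x. open {p}")
      \<comment> \<open>The action carries an isolated point to every other point by homeomorphisms,
        so the space is discrete and no nonempty set is meagre.\<close>
      case True
      then obtain p :: 'x where p: "open {p}" by blast
      have "open {q}" for q :: 'x
      proof -
        obtain g where "\<phi> g p = q" using transitive by blast
        then show ?thesis using open_act[OF p, of g] by simp
      qed
      then show ?thesis using meagre_isolated[of "(\<lambda>u. \<phi> u y) ` U"] U(2) by blast
    next
      case False
      interpret base_sigma_discrete_action m e iv \<phi> j
        by unfold_locales (use an False T_nm meagre_subset[of UNIV T] in auto)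
      show ?thesis by (rule nonmeagre_orbits[OF U])
    qed
  qed
  show "\<exists>\<alpha>\<in>A. \<exists>N::nat. \<phi> \<alpha> x \<in> T \<and> (\<forall>n>N. \<phi> \<alpha> (xs n) \<in> T)"
    by (rule shift_compact[OF nm lim hit])
qed

end
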